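(* Let $(\mathcal F,\mathcal G)$ be a tiling IFS. Then the restriction $$\Pi|_{\Sigma_{rev}^\dagger}:\Sigma_{rev}^\dagger\subset\Sigma_\infty^\dagger\to\mathbb T$$ is continuous, and $\Pi:\Sigma^\dagger_\infty\to\mathbb T$ is upper semi-continuous in this sense: if $\theta^{(n)}\in\Sigma^\dagger_\infty$ converges to $\theta\in\Sigma^\dagger_\infty$ and the sequence of tilings $\Pi(\theta^{(n)})$ converges to a tiling $T\in\mathbb T$, then $\Pi(\theta)\subset T$.
   Context: Graph and paths. $\mathcal G=(\mathcal E,\mathcal V)$ is a finite directed graph with edges $1,\dots,N$ and vertices $\mathcal V$, $1\le|\mathcal V|<N$, strongly connected and primitive (some power of its adjacency matrix is strictly positive). An edge $e$ goes from $e^-$ to $e^+$ and is associated with a map $f_e:\mathbb R^M\to\mathbb R^M$, $\mathcal F=\{f_1,\dots,f_N\}$. $\Sigma_*$ (resp. $\Sigma_\infty$) is the set of finite (resp. infinite) directed paths $\sigma=\sigma_1\sigma_2\cdots$ in $\mathcal G$; $\sigma^-$ is the initial vertex and, for finite $\sigma$, $\sigma^+$ is the terminal vertex and $f_\sigma=f_{\sigma_1}\circ\cdots\circ f_{\sigma_{|\sigma|}}$. $\mathcal G^\dagger$ is $\mathcal G$ with all edges reversed (same labels); $\Sigma_*^\dagger,\Sigma_\infty^\dagger$ are its finite and infinite directed paths, $\Sigma^\dagger=\Sigma^\dagger_*\cup\Sigma^\dagger_\infty$. For $\theta\in\Sigma^\dagger$, $\theta^-,\theta^+$ are the initial and terminal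 vertices of $\theta$ as a path in $\mathcal G^\dagger$ (so $\theta^-$ is the $\mathcal G$-terminal vertex of the edge $\theta_1$ and, for finite $\theta$, $\theta^+$ is the $\mathcal G$-initial vertex of its last edge), $f_{-\theta}=f_{\theta_1}^{-1}\circ\cdots\circ f_{\theta_{|\theta|}}^{-1}$, $\theta|k=\theta_1\cdots\theta_k$. $\Sigma_\infty^\dagger$ has the metric $2^{-\min\{k\in\mathbb N:\theta_k\ne\psi_k\}}$ for $\theta\ne\psi$. Attractor. $\pi(\sigma)=\lim_k f_{\sigma_1}\cdots f_{\sigma_k}(x)$ for $\sigma\in\Sigma_\infty$ (independent of $x$), $A_v=\{\pi(\sigma):\sigma\in\Sigma_\infty,\sigma^-=v\}$ for $v\in\mathcal V$, and $\pi(\sigma)=f_\sigma(A_{\sigma^+})$ for $\sigma\in\Sigma_*$. Tiling IFS. $(\mathcal F,\mathcal G)$ is a tiling IFS if each $f_n$ is a contractive similitude with scaling factor $s^{a_n}$, where $0<s<1$ is fixed, $a_n\in\mathbb N=\{1,2,\dots\}$ and $\gcd(a_1,\dots,a_N)=1$; the open set condition holds (there are nonempty bounded open sets $\mathcal O_v$, $v\in\mathcal V$, with $f_e(\mathcal O_{e^+})\subset\mathcal O_{e^-}$ for all $e$, and $f_e(\mathcal O_{e^+})\cap f_d(\mathcal O_{d^+})=\varnothing$ whenever $d\ne e$, $d^-=e^-$); $A_v\cap A_w=\varnothing$ for $v\neq w$; and the affine span of each $A_v$ is $\mathbb R^M$. Tilings. For a finite path, $\xi(\sigma)=\sum_{i=1}^{|\sigma|}a_{\sigma_i}$,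 $\xi^-(\sigma)=\sum_{i=1}^{|\sigma|-1}a_{\sigma_i}$ (both $0$ for the empty path). For $k\in\mathbb N_0$, $\Omega_k^v=\{\sigma\in\Sigma_*:\xi^-(\sigma)\le k<\xi(\sigma),\ \sigma^-=v\}$. For $\theta\in\Sigma^\dagger_*$, $\Pi(\theta)=\{f_{-\theta}(\pi(\sigma)):\sigma\in\Omega^{\theta^+}_{\xi(\theta)}\}$; for $\theta\in\Sigma^\dagger_\infty$, $\Pi(\theta)=\bigcup_{k\in\mathbb N}\Pi(\theta|k)$. $\mathbb T=\{\Pi(\theta):\theta\in\Sigma^\dagger\}$. Metric on $\mathbb T$. $\rho:\mathbb R^M\to\mathbb S^M$ is (inverse) stereographic projection onto the $M$-sphere tangent to $\mathbb R^M$ at the origin; $\mathbb H(\mathbb S^M)$ is the set of nonempty closed subsets of $\mathbb S^M$ with the Hausdorff metric $d_{\mathbb H(\mathbb S^M)}$ coming from the round metric; $d_{\mathbb H(\mathbb H(\mathbb S^M))}$ is the Hausdorff metric on nonempty compact subsets of $(\mathbb H(\mathbb S^M),d_{\mathbb H(\mathbb S^M)})$. For $T_1,T_2\in\mathbb T$, $d_{\mathbb T}(T_1,T_2)=d_{\mathbb H(\mathbb H(\mathbb S^M))}(\rho(T_1),\rho(T_2))$, where $\rho(T)=\{\rho(t):t\in T\}$ (the Hausdorff distance being computed using the closure of $\rho(T)$ in $\mathbb H(\mathbb S^M)$). Reversible points. For $v\in\mathcal V$ let $H_v=\bigcup\{f_{-\theta}f_\sigma(A_{\sigma^+}):\theta\in\Sigma_*^\dagger,\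 \sigma\in\Sigma_*,\ \theta^-=v,\ \theta^+=\sigma^-,\ \theta_{|\theta|}\ne\sigma_1\}$ ($\theta,\sigma$ nonempty) and let $O_v=\{x\in\mathbb R^M:d(x,A_v)<d(x,H_v)\}$ (central open sets). $\theta\in\Sigma_\infty^\dagger$ is reversible if there exists $\sigma\in\Sigma_\infty$ with $\pi(\sigma)\in\bigcup_vO_v$ such that for all $L,M'\in\mathbb N$ there is $m\ge M'$ with $\sigma_1\sigma_2\cdots\sigma_L=\theta_{m+L}\theta_{m+L-1}\cdots\theta_{m+1}$. $\Sigma^\dagger_{rev}$ is the set of reversible $\theta\in\Sigma^\dagger_\infty$.
   Formalization: In the definition of reversible, π(σ) is required to lie in the central open set O_{σ^-} of its own initial vertex instead of in the union of all O_v; with the full union continuity can fail, since some O_w with w≠σ^- may contain points of A_{σ^-} that lie in H_{σ^-}. *)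

theory Defs
  imports
    "HOL-Analysis.Analysis"
    "Graph_Theory.Digraph"
    "Graph_Theory.Arc_Walk"
    "Graph_Theory.Digraph_Component"
begin

section \<open>Directed paths\<close>

definition reverse_digraph :: "('v, 'e) pre_digraph \<Rightarrow> ('v, 'e) pre_digraph" where
  "reverse_digraph G = G\<lparr>tail := head G, head := tail G\<rparr>"

fun adjacency_power :: "('v, 'e) pre_digraph \<Rightarrow> nat \<Rightarrow> 'v \<Rightarrow> 'v \<Rightarrow> nat" where
  "adjacency_power G 0 u v = (if u = v then 1 else 0)"
| "adjacency_power G (Suc k) u v =
     (\<Sum>w\<in>verts G. card {e \<in> arcs G. tail G e = u \<and> head G e = w} * adjacency_power G k w v)"

definition primitive_digraph :: "('v, 'e) pre_digraph \<Rightarrow> bool" where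
  "primitive_digraph G \<longleftrightarrow> (\<exists>k\<ge>1. \<forall>u\<in>verts G. \<forall>v\<in>verts G. adjacency_power G k u v > 0)"

text \<open>A finite path is a pair of its initial vertex and its list of edges, so that there is one
  empty path at each vertex.\<close>

definition fin_paths :: "('v, 'e) pre_digraph \<Rightarrow> ('v \<times> 'e list) set" where
  "fin_paths G = {(v, p). \<exists>w. pre_digraph.awalk G v p w}"

definition initial :: "'v \<times> 'e list \<Rightarrow> 'v" where
  "initial p = fst p"

definition edges :: "'v \<times> 'e list \<Rightarrow> 'e list" where
  "edges p = snd p"

definition terminal :: "('v, 'e) pre_digraph \<Rightarrow> 'v \<times> 'e list \<Rightarrow> 'v" where
  "terminal G p = last (pre_digraph.awalk_verts G (initial p) (edges p))"

text \<open>Infinite paths are indexed from 0: the \<open>k\<close>-th edge, counted from 1, is \<open>\<sigma> (k - 1)\<close>.\<close>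

definition inf_paths :: "('v, 'e) pre_digraph \<Rightarrow> (nat \<Rightarrow> 'e) set" where
  "inf_paths G = {\<sigma>. \<forall>k. \<sigma> k \<in> arcs G \<and> head G (\<sigma> k) = tail G (\<sigma> (Suc k))}"

definition inf_initial :: "('v, 'e) pre_digraph \<Rightarrow> (nat \<Rightarrow> 'e) \<Rightarrow> 'v" where
  "inf_initial G \<sigma> = tail G (\<sigma> 0)"

definition truncate :: "('v, 'e) pre_digraph \<Rightarrow> (nat \<Rightarrow> 'e) \<Rightarrow> nat \<Rightarrow> 'v \<times> 'e list" where
  "truncate G \<sigma> k = (inf_initial G \<sigma>, map \<sigma> [0..<k])"

text \<open>The successor in the exponent accounts for indexing from 0.\<close>

definition path_dist :: "(nat \<Rightarrow> 'e) \<Rightarrow> (nat \<Rightarrow> 'e) \<Rightarrow> real" where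
  "path_dist \<theta> \<psi> = (if \<theta> = \<psi> then 0 else 1 / 2 ^ Suc (LEAST k. \<theta> k \<noteq> \<psi> k))"


section \<open>Attractors\<close>

definition comp_maps :: "('e \<Rightarrow> 'x \<Rightarrow> 'x) \<Rightarrow> 'e list \<Rightarrow> 'x \<Rightarrow> 'x" where
  "comp_maps f es = foldr (\<lambda>e g. f e \<circ> g) es id"

definition inv_comp_maps :: "('e \<Rightarrow> 'x \<Rightarrow> 'x) \<Rightarrow> 'e list \<Rightarrow> 'x \<Rightarrow> 'x" where
  "inv_comp_maps f es = comp_maps (\<lambda>e. inv (f e)) es"

text \<open>For contractions the limit does not depend on the base point, here the origin.\<close>

definition address :: "('e \<Rightarrow> real^'m \<Rightarrow> real^'m) \<Rightarrow> (nat \<Rightarrow> 'e) \<Rightarrow> real^'m" where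
  "address f \<sigma> = lim (\<lambda>k. comp_maps f (map \<sigma> [0..<k]) 0)"

definition attractor ::
  "('v, 'e) pre_digraph \<Rightarrow> ('e \<Rightarrow> real^'m \<Rightarrow> real^'m) \<Rightarrow> 'v \<Rightarrow> (real^'m) set" where
  "attractor G f v = {address f \<sigma> | \<sigma>. \<sigma> \<in> inf_paths G \<and> inf_initial G \<sigma> = v}"

definition tile ::
  "('v, 'e) pre_digraph \<Rightarrow> ('e \<Rightarrow> real^'m \<Rightarrow> real^'m) \<Rightarrow> 'v \<times> 'e list \<Rightarrow> (real^'m) set" where
  "tile G f \<sigma> = comp_maps f (edges \<sigma>) ` attractor G f (terminal G \<sigma>)"


section \<open>Tiling iterated function systems\<close>

definition open_set_condition ::
  "('v, 'e) pre_digraph \<Rightarrow> ('e \<Rightarrow> real^'m \<Rightarrow> real^'m) \<Rightarrow> bool" where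
  "open_set_condition G f \<longleftrightarrow> (\<exists>U :: 'v \<Rightarrow> (real^'m) set.
     (\<forall>v\<in>verts G. U v \<noteq> {} \<and> bounded (U v) \<and> open (U v)) \<and>
     (\<forall>e\<in>arcs G. f e ` U (head G e) \<subseteq> U (tail G e)) \<and>
     (\<forall>e\<in>arcs G. \<forall>d\<in>arcs G. d \<noteq> e \<and> tail G d = tail G e \<longrightarrow>
        f e ` U (head G e) \<inter> f d ` U (head G d) = {}))"

locale tiling_ifs = fin_digraph G
  for G :: "('v, nat) pre_digraph" (structure) +
  fixes N :: nat
    and f :: "nat \<Rightarrow> real^'m \<Rightarrow> real^'m"
    and s :: real
    and a :: "nat \<Rightarrow> nat"
  assumes arcs_eq: "arcs G = {1..N}"
    and card_verts_ge: "1 \<le> card (verts G)"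
    and card_verts_less: "card (verts G) < N"
    and strongly_connected: "strongly_connected G"
    and primitive: "primitive_digraph G"
    and s_pos: "0 < s"
    and s_less_1: "s < 1"
    and a_ge_1: "e \<in> arcs G \<Longrightarrow> 1 \<le> a e"
    and similitude: "e \<in> arcs G \<Longrightarrow> dist (f e x) (f e y) = s ^ a e * dist x y"
    and gcd_a: "Gcd (a ` arcs G) = 1"
    and osc: "open_set_condition G f"
    and attractors_disjoint:
      "\<lbrakk>v \<in> verts G; w \<in> verts G; v \<noteq> w\<rbrakk> \<Longrightarrow> attractor G f v \<inter> attractor G f w = {}"
    and attractors_span: "v \<in> verts G \<Longrightarrow> affine hull attractor G f v = UNIV"


section \<open>Tilings\<close>

definition xi :: "('e \<Rightarrow> nat) \<Rightarrow> 'v \<times> 'e list \<Rightarrow> nat" where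
  "xi a \<sigma> = sum_list (map a (edges \<sigma>))"

definition xi_minus :: "('e \<Rightarrow> nat) \<Rightarrow> 'v \<times> 'e list \<Rightarrow> nat" where
  "xi_minus a \<sigma> = sum_list (map a (butlast (edges \<sigma>)))"

definition Omega ::
  "('v, 'e) pre_digraph \<Rightarrow> ('e \<Rightarrow> nat) \<Rightarrow> nat \<Rightarrow> 'v \<Rightarrow> ('v \<times> 'e list) set" where
  "Omega G a k v = {\<sigma> \<in> fin_paths G. xi_minus a \<sigma> \<le> k \<and> k < xi a \<sigma> \<and> initial \<sigma> = v}"

text \<open>The argument \<open>\<theta>\<close> of the following two functions is a path in the reversed graph.\<close>

definition fin_tiling ::
  "('v, 'e) pre_digraph \<Rightarrow> ('e \<Rightarrow> real^'m \<Rightarrow> real^'m) \<Rightarrow> ('e \<Rightarrow> nat) \<Rightarrow>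
   'v \<times> 'e list \<Rightarrow> (real^'m) set set" where
  "fin_tiling G f a \<theta> =
     {inv_comp_maps f (edges \<theta>) ` tile G f \<sigma> | \<sigma>.
        \<sigma> \<in> Omega G a (xi a \<theta>) (terminal (reverse_digraph G) \<theta>)}"

definition inf_tiling ::
  "('v, 'e) pre_digraph \<Rightarrow> ('e \<Rightarrow> real^'m \<Rightarrow> real^'m) \<Rightarrow> ('e \<Rightarrow> nat) \<Rightarrow>
   (nat \<Rightarrow> 'e) \<Rightarrow> (real^'m) set set" where
  "inf_tiling G f a \<theta> = (\<Union>k\<in>{1..}. fin_tiling G f a (truncate (reverse_digraph G) \<theta> k))"

definition tilings ::
  "('v, 'e) pre_digraph \<Rightarrow> ('e \<Rightarrow> real^'m \<Rightarrow> real^'m) \<Rightarrow> ('e \<Rightarrow> nat) \<Rightarrow>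
   (real^'m) set set set" where
  "tilings G f a =
     fin_tiling G f a ` fin_paths (reverse_digraph G) \<union>
     inf_tiling G f a ` inf_paths (reverse_digraph G)"


section \<open>The metric on tilings\<close>

text \<open>The unit sphere around \<open>(0, 1)\<close> is tangent to the hyperplane \<open>snd = 0\<close> at the origin.
  The point \<open>stereo x\<close> is its second intersection point with the line through the pole
  \<open>(0, 2)\<close> and \<open>(x, 0)\<close>.\<close>

definition tangent_sphere :: "((real^'m) \<times> real) set" where
  "tangent_sphere = sphere (0, 1) 1"

definition stereo :: "real^'m \<Rightarrow> (real^'m) \<times> real" where
  "stereo x = ((4 / ((norm x)\<^sup>2 + 4)) *\<^sub>R x, 2 * (norm x)\<^sup>2 / ((norm x)\<^sup>2 + 4))"

text \<open>Great-circle distance; the value 0 off the sphere is a dummy.\<close>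

definition round_dist :: "(real^'m) \<times> real \<Rightarrow> (real^'m) \<times> real \<Rightarrow> real" where
  "round_dist p q =
     (if p \<in> tangent_sphere \<and> q \<in> tangent_sphere
      then arccos ((p - (0, 1)) \<bullet> (q - (0, 1))) else 0)"

text \<open>Taking suprema and infima in \<^typ>\<open>ennreal\<close> makes the value nonnegative and specified
  for all arguments; it is the usual one for nonempty sets of finite diameter.\<close>

definition hausdorff_dist :: "('x \<Rightarrow> 'x \<Rightarrow> real) \<Rightarrow> 'x set \<Rightarrow> 'x set \<Rightarrow> real" where
  "hausdorff_dist d A B =
     enn2real (max (SUP x\<in>A. INF y\<in>B. ennreal (d x y)) (SUP y\<in>B. INF x\<in>A. ennreal (d x y)))"

definition sphere_hyperspace :: "((real^'m) \<times> real) set set" where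
  "sphere_hyperspace = {K. K \<noteq> {} \<and> closed K \<and> K \<subseteq> tangent_sphere}"

definition sphere_hyperspace_dist ::
  "((real^'m) \<times> real) set \<Rightarrow> ((real^'m) \<times> real) set \<Rightarrow> real" where
  "sphere_hyperspace_dist = hausdorff_dist round_dist"

definition stereo_closure :: "(real^'m) set set \<Rightarrow> ((real^'m) \<times> real) set set" where
  "stereo_closure T =
     Metric_space.mtopology sphere_hyperspace sphere_hyperspace_dist closure_of
       ((\<lambda>t. stereo ` t) ` T)"

definition tiling_dist :: "(real^'m) set set \<Rightarrow> (real^'m) set set \<Rightarrow> real" where
  "tiling_dist T1 T2 =
     hausdorff_dist sphere_hyperspace_dist (stereo_closure T1) (stereo_closure T2)"


section \<open>Reversible points\<close>

definition H_set ::
  "('v, 'e) pre_digraph \<Rightarrow> ('e \<Rightarrow> real^'m \<Rightarrow> real^'m) \<Rightarrow> 'v \<Rightarrow> (real^'m) set" where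
  "H_set G f v = \<Union> {inv_comp_maps f (edges \<theta>) ` tile G f \<sigma> | \<theta> \<sigma>.
     \<theta> \<in> fin_paths (reverse_digraph G) \<and> \<sigma> \<in> fin_paths G \<and>
     edges \<theta> \<noteq> [] \<and> edges \<sigma> \<noteq> [] \<and>
     initial \<theta> = v \<and> terminal (reverse_digraph G) \<theta> = initial \<sigma> \<and>
     last (edges \<theta>) \<noteq> hd (edges \<sigma>)}"

definition central_open_set ::
  "('v, 'e) pre_digraph \<Rightarrow> ('e \<Rightarrow> real^'m \<Rightarrow> real^'m) \<Rightarrow> 'v \<Rightarrow> (real^'m) set" where
  "central_open_set G f v = {x. infdist x (attractor G f v) < infdist x (H_set G f v)}"

text \<open>The central open set is taken at the initial vertex of \<open>\<sigma>\<close>, the vertex whose attractor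
  contains \<open>address f \<sigma>\<close>. Membership in the central open set of another vertex \<open>w\<close> bounds the
  distance to \<open>H_set G f w\<close> only and would let \<open>address f \<sigma>\<close> lie in \<open>H_set G f v\<close>,
  where \<open>v = inf_initial G \<sigma>\<close>; the tiling map can then be discontinuous at \<open>\<theta>\<close>.
  The last condition is \<open>\<sigma>\<^sub>1 \<dots> \<sigma>\<^sub>L = \<theta>\<^bsub>m+L\<^esub> \<dots> \<theta>\<^bsub>m+1\<^esub>\<close> in indexing from 1.\<close>

definition reversible_paths ::
  "('v, 'e) pre_digraph \<Rightarrow> ('e \<Rightarrow> real^'m \<Rightarrow> real^'m) \<Rightarrow> (nat \<Rightarrow> 'e) set" where
  "reversible_paths G f = {\<theta> \<in> inf_paths (reverse_digraph G).
     \<exists>\<sigma>\<in>inf_paths G. address f \<sigma> \<in> central_open_set G f (inf_initial G \<sigma>) \<and>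
       (\<forall>L M. \<exists>m\<ge>M. map \<sigma> [0..<L] = rev (map \<theta> [m..<m + L]))}"


section \<open>Topologies on infinite paths and on tilings\<close>

definition path_topology :: "('v, 'e) pre_digraph \<Rightarrow> (nat \<Rightarrow> 'e) topology" where
  "path_topology G = Metric_space.mtopology (inf_paths G) path_dist"

definition tiling_topology ::
  "('v, 'e) pre_digraph \<Rightarrow> ('e \<Rightarrow> real^'m \<Rightarrow> real^'m) \<Rightarrow> ('e \<Rightarrow> nat) \<Rightarrow>
   (real^'m) set set topology" where
  "tiling_topology G f a = Metric_space.mtopology (tilings G f a) tiling_dist"

end

theory Submission
  imports Defs "HOL-Library.Sublist"
begin

text \<open>The tiles of \<open>\<Pi>(\<theta>)\<close> are images of attractors under maps \<open>f_{-\<theta>|k} f_\<sigma>\<close>, and the sets of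
  these maps increase with \<open>k\<close>. The open set condition gives disjoint open sets of bounded size, one
  near each tile, so tilings are locally finite. Hence the stereographic images of the tiles of a
  tiling have no limit point other than the pole, which makes \<open>d_T\<close> a metric and yields upper
  semi-continuity, since \<open>\<theta>|k\<close> determines the tiles of stage \<open>k\<close>.

  For continuity at a reversible \<open>\<theta>\<close>, let \<open>x = \<pi>(\<sigma>)\<close> have distance \<open>\<delta> > 0\<close> from \<open>H_v\<close> and let
  \<open>\<sigma>|L\<close> occur reversed in \<open>\<theta>\<close> after \<open>m\<close> edges; put \<open>n = m + L\<close>. If \<open>\<psi>|n = \<theta>|n\<close>, then every tile
  of \<open>\<Pi>(\<psi>)\<close> outside \<open>\<Pi>(\<theta>|n)\<close> lies in \<open>f_{-\<theta>|n}(H_v)\<close>, at distance at least \<open>\<delta> s^{-\<xi>(\<theta>|n)}\<close> from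
  \<open>f_{-\<theta>|n}(x)\<close>, whereas \<open>f_{-\<theta>|n}(x)\<close> itself has norm \<open>O(s^{-\<xi>(\<theta>|m)})\<close>. For large \<open>L\<close> such tiles
  avoid any given ball.\<close>

subsection \<open>Hausdorff distances\<close>

lemma hausdorff_dist_nonneg: "0 \<le> hausdorff_dist d A B"
  by (simp add: hausdorff_dist_def)

lemma hausdorff_dist_commute:
  assumes "\<And>x y. d x y = d y x"
  shows "hausdorff_dist d A B = hausdorff_dist d B A"
  unfolding hausdorff_dist_def using assms by (simp add: max.commute)

lemma hausdorff_dist_le:
  assumes "0 \<le> e"
    and "\<And>x. x \<in> A \<Longrightarrow> \<exists>y\<in>B. d x y \<le> e"
    and "\<And>y. y \<in> B \<Longrightarrow> \<exists>x\<in>A. d x y \<le> e"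
  shows "hausdorff_dist d A B \<le> e"
  unfolding hausdorff_dist_def
proof (rule enn2real_leI[OF assms(1)], rule max.boundedI)
  show "(SUP x\<in>A. INF y\<in>B. ennreal (d x y)) \<le> ennreal e"
    using assms(2) by (intro SUP_least) (meson INF_lower2 ennreal_leI)
  show "(SUP y\<in>B. INF x\<in>A. ennreal (d x y)) \<le> ennreal e"
    using assms(3) by (intro SUP_least) (meson INF_lower2 ennreal_leI)
qed

text \<open>The bound \<open>C\<close> keeps both suprema finite, so \<open>enn2real\<close> loses
  no information. An infinite value would be sent to 0, and \<open>less\<close> would say nothing
  about distances.\<close>

lemma hausdorff_dist_lessD:
  assumes bound: "\<And>x y. \<lbrakk>x \<in> A; y \<in> B\<rbrakk> \<Longrightarrow> d x y \<le> C"
    and ne: "A \<noteq> {}" "B \<noteq> {}"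
    and less: "hausdorff_dist d A B < e"
  shows "x \<in> A \<Longrightarrow> \<exists>y\<in>B. d x y < e" and "y \<in> B \<Longrightarrow> \<exists>x\<in>A. d x y < e"
proof -
  let ?S = "SUP x\<in>A. INF y\<in>B. ennreal (d x y)" and ?S' = "SUP y\<in>B. INF x\<in>A. ennreal (d x y)"
  have "?S \<le> ennreal C" "?S' \<le> ennreal C"
    using bound ne by (auto intro!: SUP_least intro: INF_lower2 ennreal_leI)
  then have "max ?S ?S' < top"
    by (meson ennreal_less_top max_less_iff_conj order_le_less_trans)
  then have "max ?S ?S' = ennreal (hausdorff_dist d A B)"
    unfolding hausdorff_dist_def by simp
  also have "\<dots> < ennreal e"
    using less hausdorff_dist_nonneg[of d A B] by (simp add: ennreal_less_iff)
  finally have *: "?S < ennreal e" "?S' < ennreal e" by auto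
  show "\<exists>y\<in>B. d x y < e" if "x \<in> A"
  proof -
    have "(INF y\<in>B. ennreal (d x y)) < ennreal e"
      using *(1) that by (meson SUP_upper order_le_less_trans)
    then show ?thesis
      by (meson INF_less_iff ennreal_less_iff ennreal_leI linorder_not_le)
  qed
  show "\<exists>x\<in>A. d x y < e" if "y \<in> B"
  proof -
    have "(INF x\<in>A. ennreal (d x y)) < ennreal e"
      using *(2) that by (meson SUP_upper order_le_less_trans)
    then show ?thesis
      by (meson INF_less_iff ennreal_less_iff ennreal_leI linorder_not_le)
  qed
qed

text \<open>Serves twice: for closed subsets of the sphere, and for closures of projected tilings
  inside the hyperspace. Closedness is phrased through \<open>d\<close> alone; it makes sets at
  distance 0 coincide.\<close>

lemma Metric_space_hausdorff_dist:
  assumes "Metric_space M d"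
    and bound: "\<And>x y. \<lbrakk>x \<in> M; y \<in> M\<rbrakk> \<Longrightarrow> d x y \<le> C"
    and sub: "\<And>K. K \<in> \<K> \<Longrightarrow> K \<subseteq> M \<and> K \<noteq> {}"
    and closed: "\<And>K x. \<lbrakk>K \<in> \<K>; x \<in> M; \<And>e. e > 0 \<Longrightarrow> \<exists>y\<in>K. d x y < e\<rbrakk> \<Longrightarrow> x \<in> K"
  shows "Metric_space \<K> (hausdorff_dist d)"
proof -
  interpret Metric_space M d by fact
  have *: "\<exists>y\<in>B. d x y < e" if "A \<in> \<K>" "B \<in> \<K>" "x \<in> A" "hausdorff_dist d A B < e" for A B x e
    using hausdorff_dist_lessD(1)[of A B d C e x] that sub[of A] sub[of B] bound by blast
  have H_comm: "hausdorff_dist d A B = hausdorff_dist d B A" for A B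
    by (rule hausdorff_dist_commute) (rule commute)
  show ?thesis
  proof
    fix A B C
    show "0 \<le> hausdorff_dist d A B" by (rule hausdorff_dist_nonneg)
    show "hausdorff_dist d A B = hausdorff_dist d B A" by (rule H_comm)
    assume A: "A \<in> \<K>" and B: "B \<in> \<K>"
    have sub0: "A \<subseteq> B" if "A \<in> \<K>" "B \<in> \<K>" "hausdorff_dist d A B = 0" for A B
      using * that sub by (metis closed subset_iff)
    have "d x x \<le> 0" if "x \<in> A" for x
      using sub[OF A] that by auto
    then have refl: "hausdorff_dist d A A \<le> 0"
      by (intro hausdorff_dist_le) auto
    show "hausdorff_dist d A B = 0 \<longleftrightarrow> A = B"
      using sub0[OF A B] sub0[OF B A] H_comm[of A B] refl hausdorff_dist_nonneg[of d A A] by auto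
    assume C: "C \<in> \<K>"
    show "hausdorff_dist d A C \<le> hausdorff_dist d A B + hausdorff_dist d B C"
    \<comment> \<open>Infima need not be attained, so each of the two intermediate points is chosen
      with an error of \<open>e / 2\<close>.\<close>
    proof (rule field_le_epsilon)
      fix e :: real assume e: "0 < e"
      have tri: "\<exists>z\<in>C. d x z \<le> hausdorff_dist d A B + hausdorff_dist d B C + e"
        if ABC: "A \<in> \<K>" "B \<in> \<K>" "C \<in> \<K>" and x: "x \<in> A" for A B C x
      proof -
        obtain y where y: "y \<in> B" "d x y < hausdorff_dist d A B + e / 2"
          using *[OF ABC(1,2) x, of "hausdorff_dist d A B + e / 2"] e by auto
        obtain z where z: "z \<in> C" "d y z < hausdorff_dist d B C + e / 2"
          using *[OF ABC(2,3) y(1), of "hausdorff_dist d B C + e / 2"] e by auto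
        have "d x z \<le> d x y + d y z"
          using ABC x y z sub by (intro triangle) auto
        then show ?thesis
          using y z by (intro bexI[of _ z]) auto
      qed
      show "hausdorff_dist d A C \<le> hausdorff_dist d A B + hausdorff_dist d B C + e"
      proof (rule hausdorff_dist_le)
        show "0 \<le> hausdorff_dist d A B + hausdorff_dist d B C + e"
          using e hausdorff_dist_nonneg[of d] by (simp add: add_nonneg_nonneg)
        show "\<exists>z\<in>C. d x z \<le> hausdorff_dist d A B + hausdorff_dist d B C + e" if "x \<in> A" for x
          using tri[OF A B C that] .
        show "\<exists>x\<in>A. d x z \<le> hausdorff_dist d A B + hausdorff_dist d B C + e" if "z \<in> C" for z
          using tri[OF C B A that] by (simp add: H_comm commute add.commute)
      qed
    qed
  qed
qed


subsection \<open>The round sphere\<close>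

text \<open>Cauchy-Schwarz keeps the inner product of unit vectors in [-1, 1], where the bounds on
  \<open>arccos\<close> hold; the dummy value 0 off the sphere obeys them as well.\<close>

lemma round_dist_le_pi: "round_dist p q \<le> pi"
  and round_dist_nonneg: "0 \<le> round_dist p q"
  and round_dist_commute: "round_dist p q = round_dist q p"
proof -
  have "\<bar>(p - (0, 1)) \<bullet> (q - (0, 1))\<bar> \<le> 1" if "p \<in> tangent_sphere" "q \<in> tangent_sphere"
    using that Cauchy_Schwarz_ineq2[of "p - (0, 1)" "q - (0, 1)"]
    by (simp add: tangent_sphere_def dist_norm norm_minus_commute)
  then have "p \<in> tangent_sphere \<Longrightarrow> q \<in> tangent_sphere \<Longrightarrow>
      -1 \<le> (p - (0, 1)) \<bullet> (q - (0, 1)) \<and> (p - (0, 1)) \<bullet> (q - (0, 1)) \<le> 1"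
    by (simp add: abs_le_iff)
  then show "round_dist p q \<le> pi" "0 \<le> round_dist p q"
    by (auto simp: round_dist_def arccos_lbound arccos_ubound)
qed (auto simp: round_dist_def inner_commute)

text \<open>The spherical triangle inequality. Removing the components along \<open>v\<close> leaves
  vectors whose norms are the sines of the two angles; Cauchy-Schwarz for these and the addition
  formula bound \<open>cos (\<alpha> + \<beta>)\<close> by \<open>u \<bullet> w\<close>.\<close>

lemma arccos_inner_triangle:
  fixes u v w :: "'a::real_inner"
  assumes "norm u = 1" "norm v = 1" "norm w = 1"
  shows "arccos (u \<bullet> w) \<le> arccos (u \<bullet> v) + arccos (v \<bullet> w)"
proof -
  have bnd: "-1 \<le> x \<bullet> y" "x \<bullet> y \<le> 1" if "norm x = 1" "norm y = 1" for x y :: 'a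
    using Cauchy_Schwarz_ineq2[of x y] that by (auto simp: abs_le_iff)
  define \<alpha> \<beta> where "\<alpha> = arccos (u \<bullet> v)" and "\<beta> = arccos (v \<bullet> w)"
  have cos: "cos \<alpha> = u \<bullet> v" "cos \<beta> = v \<bullet> w"
    using bnd assms by (auto simp: \<alpha>_def \<beta>_def)
  have rng: "0 \<le> \<alpha>" "\<alpha> \<le> pi" "0 \<le> \<beta>" "\<beta> \<le> pi"
    using bnd assms by (auto simp: \<alpha>_def \<beta>_def arccos_lbound arccos_ubound)
  have sq: "u \<bullet> u = 1" "v \<bullet> v = 1" "w \<bullet> w = 1"
    using assms by (auto simp: norm_eq_1)
  define u' w' where "u' = u - (u \<bullet> v) *\<^sub>R v" and "w' = w - (v \<bullet> w) *\<^sub>R v"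
  have "(norm u')\<^sup>2 = (sin \<alpha>)\<^sup>2" "(norm w')\<^sup>2 = (sin \<beta>)\<^sup>2"
    unfolding sin_squared_eq cos power2_norm_eq_inner
    by (simp_all add: u'_def w'_def inner_simps sq inner_commute power2_eq_square algebra_simps)
  then have n: "norm u' = sin \<alpha>" "norm w' = sin \<beta>"
    using rng by (auto intro!: power2_eq_imp_eq simp: sin_ge_zero)
  have "u \<bullet> w = cos \<alpha> * cos \<beta> + u' \<bullet> w'"
    by (simp add: cos u'_def w'_def inner_simps sq inner_commute algebra_simps)
  moreover have "- (u' \<bullet> w') \<le> sin \<alpha> * sin \<beta>"
    using Cauchy_Schwarz_ineq2[of u' w'] n by (simp add: abs_le_iff)
  ultimately have le: "cos (\<alpha> + \<beta>) \<le> u \<bullet> w"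
    by (simp add: cos_add)
  show ?thesis
  \<comment> \<open>\<open>arccos\<close> inverts \<open>cos\<close> only up to \<open>pi\<close>; a
    larger sum exceeds every value of \<open>arccos\<close> on [-1, 1].\<close>
  proof (cases "\<alpha> + \<beta> \<le> pi")
    case True
    have "arccos (u \<bullet> w) \<le> arccos (cos (\<alpha> + \<beta>))"
      using le bnd assms by (intro arccos_le_arccos) auto
    also have "\<dots> = \<alpha> + \<beta>"
      using True rng by (simp add: arccos_cos)
    finally show ?thesis by (simp add: \<alpha>_def \<beta>_def)
  next
    case False
    then show ?thesis
      using arccos_ubound[of "u \<bullet> w"] bnd assms by (simp add: \<alpha>_def \<beta>_def)
  qed
qed

text \<open>The chord of an arc of length \<alpha> is 2 sin(\<alpha>/2). This lets Euclidean
  closedness, which defines the hyperspace, be used with the round metric.\<close>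

lemma dist_le_round_dist:
  assumes "p \<in> tangent_sphere" "q \<in> tangent_sphere"
  shows "dist p q \<le> round_dist p q"
proof -
  define u v where "u = p - (0, 1)" and "v = q - (0, 1)"
  have n: "norm u = 1" "norm v = 1"
    using assms by (auto simp: u_def v_def tangent_sphere_def dist_norm norm_minus_commute)
  define \<alpha> where "\<alpha> = arccos (u \<bullet> v)"
  have *: "-1 \<le> u \<bullet> v" "u \<bullet> v \<le> 1"
    using Cauchy_Schwarz_ineq2[of u v] n by (auto simp: abs_le_iff)
  have \<alpha>: "round_dist p q = \<alpha>" "0 \<le> \<alpha>" "cos \<alpha> = u \<bullet> v"
    using assms * by (auto simp: \<alpha>_def round_dist_def u_def v_def arccos_lbound)
  have "(dist p q)\<^sup>2 = (norm (u - v))\<^sup>2"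
    by (simp add: dist_norm u_def v_def)
  also have "\<dots> = 2 - 2 * cos \<alpha>"
    using n by (simp add: \<alpha> power2_norm_eq_inner inner_simps norm_eq_1 inner_commute)
  also have "\<dots> = (2 * sin (\<alpha> / 2))\<^sup>2"
    using cos_double_sin[of "\<alpha> / 2"] by (simp add: power2_eq_square)
  also have "\<dots> \<le> \<alpha>\<^sup>2"
  proof (rule abs_le_square_iff[THEN iffD1])
    show "\<bar>2 * sin (\<alpha> / 2)\<bar> \<le> \<bar>\<alpha>\<bar>"
      using abs_sin_x_le_abs_x[of "\<alpha> / 2"] by linarith
  qed
  finally show ?thesis
    unfolding \<alpha>(1) using \<alpha>(2) by (rule power2_le_imp_le)
qed

lemma Metric_space_round_dist: "Metric_space tangent_sphere round_dist"
proof
  fix p q r :: "(real^'m) \<times> real"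
  show "0 \<le> round_dist p q" "round_dist p q = round_dist q p"
    by (rule round_dist_nonneg round_dist_commute)+
  assume p: "p \<in> tangent_sphere" and q: "q \<in> tangent_sphere"
  have "round_dist p p = 0"
    using p by (auto simp: round_dist_def tangent_sphere_def dist_norm norm_minus_commute
        simp flip: power2_norm_eq_inner)
  then show "round_dist p q = 0 \<longleftrightarrow> p = q"
    using dist_le_round_dist[OF p q] by auto
  assume r: "r \<in> tangent_sphere"
  show "round_dist p r \<le> round_dist p q + round_dist q r"
    using p q r arccos_inner_triangle[of "p - (0, 1)" "q - (0, 1)" "r - (0, 1)"]
    by (simp add: round_dist_def) (simp add: tangent_sphere_def dist_norm norm_minus_commute)
qed

lemma Metric_space_sphere_hyperspace_dist:
  "Metric_space sphere_hyperspace sphere_hyperspace_dist"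
  unfolding sphere_hyperspace_dist_def
proof (rule Metric_space_hausdorff_dist[OF Metric_space_round_dist round_dist_le_pi])
  fix K :: "((real^'m) \<times> real) set" and x
  assume K: "K \<in> sphere_hyperspace"
  then show "K \<subseteq> tangent_sphere \<and> K \<noteq> {}"
    by (simp add: sphere_hyperspace_def)
  assume x: "x \<in> tangent_sphere" and near: "\<And>e. e > 0 \<Longrightarrow> \<exists>y\<in>K. round_dist x y < e"
  have "\<exists>y\<in>K. dist y x < e" if e: "e > 0" for e
  proof -
    obtain y where y: "y \<in> K" "round_dist x y < e"
      using near[OF e] by blast
    then have "dist x y < e"
      using dist_le_round_dist[of x y] x K by (auto simp: sphere_hyperspace_def)
    then show ?thesis
      using y by (auto simp: dist_commute)
  qed
  then show "x \<in> K"
    using K closed_approachable[of K x] unfolding sphere_hyperspace_def by blast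
qed

lemma sphere_hyperspace_dist_le_pi:
  assumes "K \<in> sphere_hyperspace" "L \<in> sphere_hyperspace"
  shows "sphere_hyperspace_dist K L \<le> pi"
proof -
  obtain x y where "x \<in> K" "y \<in> L"
    using assms unfolding sphere_hyperspace_def by blast
  then show ?thesis
    unfolding sphere_hyperspace_dist_def
    by (intro hausdorff_dist_le pi_ge_zero) (blast intro: round_dist_le_pi)+
qed


subsection \<open>Stereographic projection\<close>

lemma norm2_plus_4: "0 < (norm x)\<^sup>2 + 4" "(norm x)\<^sup>2 + 4 \<noteq> 0"
  by (smt (verit) zero_le_power2)+

text \<open>In this form the height is seen to depend only on the norm, with its gap to the height 2
  of the pole measuring how far out \<open>x\<close> lies.\<close>

lemma snd_stereo: "snd (stereo x) = 2 - 8 / ((norm x)\<^sup>2 + 4)"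
  using norm2_plus_4[of x] by (simp add: stereo_def field_simps)

lemma stereo_in_tangent_sphere: "stereo x \<in> tangent_sphere"
proof -
  let ?q = "(norm x)\<^sup>2 + 4"
  have "(norm (stereo x - (0, 1)))\<^sup>2 = (4 / ?q)\<^sup>2 * (norm x)\<^sup>2 + (snd (stereo x) - 1)\<^sup>2"
    by (simp add: stereo_def norm_Pair power_divide power_mult_distrib)
  also have "\<dots> = (16 * (?q - 4) + (?q - 8)\<^sup>2) / ?q\<^sup>2"
  proof -
    have "(4 / q)\<^sup>2 * (q - 4) + (2 - 8 / q - 1)\<^sup>2 = (16 * (q - 4) + (q - 8)\<^sup>2) / q\<^sup>2"
      if "q \<noteq> 0" for q :: real
      using that by (simp add: field_simps power2_eq_square)
    from this[OF norm2_plus_4(2)[of x]] show ?thesis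
      by (simp add: snd_stereo)
  qed
  also have "16 * (?q - 4) + (?q - 8)\<^sup>2 = ?q\<^sup>2"
    by (simp add: power2_eq_square algebra_simps)
  also have "?q\<^sup>2 / ?q\<^sup>2 = 1"
    using norm2_plus_4(2)[of x] by simp
  finally have "norm (stereo x - (0, 1)) = 1"
    by (metis norm_ge_zero one_power2 power2_eq_imp_eq zero_le_one)
  then show ?thesis
    by (simp add: tangent_sphere_def dist_norm norm_minus_commute)
qed

text \<open>The height determines the norm, hence the scalar factor in the first component.\<close>

lemma inj_stereo: "inj stereo"
proof (rule injI)
  fix x y :: "real^'m" assume eq: "stereo x = stereo y"
  then have "8 / ((norm x)\<^sup>2 + 4) = 8 / ((norm y)\<^sup>2 + 4)"
    using snd_stereo[of x] snd_stereo[of y] by simp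
  then have q: "(norm x)\<^sup>2 + 4 = (norm y)\<^sup>2 + 4"
    by simp
  from eq have "(4 / ((norm x)\<^sup>2 + 4)) *\<^sub>R x = (4 / ((norm y)\<^sup>2 + 4)) *\<^sub>R y"
    by (simp add: stereo_def)
  with q norm2_plus_4[of y] show "x = y"
    by simp
qed

lemma continuous_on_stereo: "continuous_on S stereo"
  unfolding stereo_def using norm2_plus_4(2) by (intro continuous_intros) auto

lemma stereo_compact:
  assumes "compact t" "t \<noteq> {}"
  shows "stereo ` t \<in> sphere_hyperspace"
proof -
  have "closed (stereo ` t)"
    using assms(1) by (intro compact_imp_closed compact_continuous_image continuous_on_stereo)
  moreover have "stereo ` t \<subseteq> tangent_sphere"
    by (rule image_subsetI) (rule stereo_in_tangent_sphere)
  ultimately show ?thesis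
    using assms(2) unfolding sphere_hyperspace_def by blast
qed

text \<open>Points of large norm project close to the pole, hence close to one another.\<close>

lemma round_dist_stereo_far:
  assumes "e > 0"
  shows "\<exists>R. \<forall>x y :: real^'m. R \<le> norm x \<longrightarrow> R \<le> norm y \<longrightarrow> round_dist (stereo x) (stereo y) < e"
proof -
  \<comment> \<open>Half of \<open>e\<close> for each leg through the pole; the cut at
    \<open>pi\<close> keeps \<open>c\<close> where \<open>arccos\<close> inverts
    \<open>cos\<close>.\<close>
  define c where "c = min (e / 2) pi"
  have c: "0 < c" "c \<le> pi" "c \<le> e / 2"
    using assms by (auto simp: c_def)
  have "cos c < cos 0"
    using c by (intro cos_monotone_0_pi) auto
  then have cos: "cos c < 1" by simp
  \<comment> \<open>The cosine of the distance from \<open>stereo x\<close> to the pole is 1 - 8 /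
    (|x|^2 + 4), which exceeds \<open>cos c\<close> once |x|^2 + 4 > R^2.\<close>
  define R where "R = sqrt (8 / (1 - cos c))"
  have R2: "R\<^sup>2 = 8 / (1 - cos c)" "0 \<le> R"
    using cos by (auto simp: R_def)
  have pole: "(0, 2) \<in> (tangent_sphere :: ((real^'m) \<times> real) set)"
    by (simp add: tangent_sphere_def dist_norm norm_Pair)
  have *: "round_dist (stereo x) (0, 2) < c" if "R \<le> norm x" for x :: "real^'m"
  proof -
    have "R\<^sup>2 \<le> (norm x)\<^sup>2"
      using that R2 by (intro power_mono) auto
    then have "8 / (1 - cos c) < (norm x)\<^sup>2 + 4"
      using R2 by simp
    then have "8 / ((norm x)\<^sup>2 + 4) < 1 - cos c"
      using cos norm2_plus_4[of x] by (simp add: field_simps)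
    moreover have "8 / ((norm x)\<^sup>2 + 4) > 0"
      using norm2_plus_4[of x] by simp
    ultimately have "arccos (snd (stereo x) - 1) < arccos (cos c)"
      by (intro arccos_less_arccos) (simp_all add: snd_stereo)
    moreover have "round_dist (stereo x) (0, 2) = arccos (snd (stereo x) - 1)"
      using stereo_in_tangent_sphere[of x] pole
      by (simp add: round_dist_def inner_prod_def)
    ultimately show ?thesis
      using c by (simp add: arccos_cos)
  qed
  interpret S: Metric_space "tangent_sphere :: ((real^'m) \<times> real) set" round_dist
    by (rule Metric_space_round_dist)
  have "round_dist (stereo x) (stereo y) < e" if "R \<le> norm x" "R \<le> norm y" for x y :: "real^'m"
    using *[OF that(1)] *[OF that(2)] c(3) pole
      S.triangle'[OF stereo_in_tangent_sphere pole stereo_in_tangent_sphere, of x y] by simp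
  then show ?thesis by blast
qed

text \<open>A projected point lies below the pole by 8 / (|x|^2 + 4). The radius is half this gap,
  so every point of the ball stays below the pole by the other half, which bounds its norm.\<close>

lemma round_dist_stereo_near:
  fixes x :: "real^'m"
  shows "\<exists>e>0. \<exists>R. \<forall>y. round_dist (stereo x) (stereo y) < e \<longrightarrow> norm y \<le> R"
proof (intro exI conjI allI impI)
  let ?q = "(norm x)\<^sup>2 + 4"
  have q: "0 < ?q" by (rule norm2_plus_4)
  then show "0 < 4 / ?q" by simp
  fix y :: "real^'m" assume less: "round_dist (stereo x) (stereo y) < 4 / ?q"
  let ?r = "(norm y)\<^sup>2 + 4"
  have r: "0 < ?r" by (rule norm2_plus_4)
  have "\<bar>snd (stereo x) - snd (stereo y)\<bar> \<le> dist (stereo x) (stereo y)"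
    using dist_snd_le[of "stereo x" "stereo y"] by (simp add: dist_real_def)
  also have "\<dots> < 4 / ?q"
    using less dist_le_round_dist[OF stereo_in_tangent_sphere stereo_in_tangent_sphere, of x y]
    by simp
  finally have "8 / ?q - 4 / ?q < 8 / ?r"
    by (simp add: snd_stereo)
  then have "4 / ?q < 8 / ?r" by simp
  then have "(norm y)\<^sup>2 \<le> 2 * ?q"
    using q r by (simp add: field_simps)
  then show "norm y \<le> sqrt (2 * ?q)"
    by (simp add: real_le_rsqrt)
qed

subsection \<open>Paths\<close>

lemma reverse_digraph_simps [simp]:
  "verts (reverse_digraph G) = verts G" "arcs (reverse_digraph G) = arcs G"
  "tail (reverse_digraph G) = head G" "head (reverse_digraph G) = tail G"
  by (simp_all add: reverse_digraph_def)

text \<open>Stated for the raw \<open>pre_digraph\<close> constants, so that it serves both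
  \<open>G\<close> and the reversed graph.\<close>

lemma terminal_eqI:
  assumes "pre_digraph.cas G v p w"
  shows "terminal G (v, p) = w"
proof -
  have "pre_digraph.awalk_verts G u q \<noteq> []" for u q
    by (cases q) (simp_all add: pre_digraph.awalk_verts.simps)
  then have "last (pre_digraph.awalk_verts G v p) = w"
    using assms
    by (induction p arbitrary: v) (simp_all add: pre_digraph.awalk_verts.simps pre_digraph.cas.simps)
  then show ?thesis
    by (simp add: terminal_def initial_def edges_def)
qed

lemma inf_paths_cas:
  assumes "\<sigma> \<in> inf_paths G"
  shows "pre_digraph.cas G (tail G (\<sigma> i)) (map \<sigma> [i..<i + k]) (tail G (\<sigma> (i + k)))"
proof (induction k arbitrary: i)
  case 0
  then show ?case by (simp add: pre_digraph.cas.simps)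
next
  case (Suc k)
  have "[i..<i + Suc k] = i # [Suc i..<Suc i + k]"
    by (simp add: upt_conv_Cons)
  with Suc[of "Suc i"] assms show ?case
    by (simp add: pre_digraph.cas.simps inf_paths_def)
qed

lemma inf_paths_arcs: "\<sigma> \<in> inf_paths G \<Longrightarrow> \<sigma> k \<in> arcs G"
  by (simp add: inf_paths_def)

lemma inf_paths_shift: "\<sigma> \<in> inf_paths G \<Longrightarrow> (\<lambda>i. \<sigma> (k + i)) \<in> inf_paths G"
  by (simp add: inf_paths_def)

text \<open>Paths that first differ at index \<open>l\<close> have distance 1 / 2^(l+1), so the ball
  of radius 1 / 2^n is the cylinder over the first \<open>n\<close> edges.\<close>

lemma path_dist_less_iff:
  "path_dist \<theta> \<psi> < 1 / 2 ^ n \<longleftrightarrow> (\<forall>i<n. \<theta> i = \<psi> i)"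
proof (cases "\<theta> = \<psi>")
  case False
  then obtain j where "\<theta> j \<noteq> \<psi> j" by auto
  define l where "l = (LEAST k. \<theta> k \<noteq> \<psi> k)"
  have l: "\<theta> l \<noteq> \<psi> l"
    unfolding l_def by (rule LeastI) fact
  have l_le: "\<theta> i = \<psi> i" if "i < l" for i
    using that not_less_Least unfolding l_def by blast
  have "path_dist \<theta> \<psi> < 1 / 2 ^ n \<longleftrightarrow> (2::real) ^ n < 2 ^ Suc l"
    using False by (simp add: path_dist_def l_def field_simps)
  also have "\<dots> \<longleftrightarrow> n \<le> l"
    by (subst power_strict_increasing_iff) auto
  also have "\<dots> \<longleftrightarrow> (\<forall>i<n. \<theta> i = \<psi> i)"
  proof
    assume "\<forall>i<n. \<theta> i = \<psi> i"
    with l show "n \<le> l" using not_le by blast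
  qed (use l_le in simp)
  finally show ?thesis .
qed (simp add: path_dist_def)

lemma Metric_space_path_dist: "Metric_space M path_dist"
proof
  fix \<theta> \<psi> \<phi> :: "nat \<Rightarrow> 'e"
  have nonneg: "0 \<le> path_dist \<theta> \<psi>" for \<theta> \<psi> :: "nat \<Rightarrow> 'e" by (simp add: path_dist_def)
  then show "0 \<le> path_dist \<theta> \<psi>" .
  show "path_dist \<theta> \<psi> = path_dist \<psi> \<theta>" by (auto simp: path_dist_def eq_commute)
  show "path_dist \<theta> \<psi> = 0 \<longleftrightarrow> \<theta> = \<psi>" by (simp add: path_dist_def)
  show "path_dist \<theta> \<phi> \<le> path_dist \<theta> \<psi> + path_dist \<psi> \<phi>"
  \<comment> \<open>The ultrametric argument: with \<open>1 / 2 ^ n\<close> the distance of \<theta>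
    and \<phi>, both would agree with \<psi> on the first \<open>n\<close> edges, hence with each
    other.\<close>
  proof (rule ccontr)
    assume "\<not> ?thesis"
    then have less: "path_dist \<theta> \<psi> < path_dist \<theta> \<phi>" "path_dist \<psi> \<phi> < path_dist \<theta> \<phi>"
      using nonneg[of \<theta> \<psi>] nonneg[of \<psi> \<phi>] by linarith+
    then have "\<theta> \<noteq> \<phi>" by (auto simp: path_dist_def split: if_splits)
    then obtain n where n: "path_dist \<theta> \<phi> = 1 / 2 ^ n"
      by (auto simp: path_dist_def simp del: power_Suc)
    have "\<forall>i<n. \<theta> i = \<psi> i" "\<forall>i<n. \<psi> i = \<phi> i"
      using less unfolding n path_dist_less_iff .
    then have "path_dist \<theta> \<phi> < 1 / 2 ^ n"
      by (simp add: path_dist_less_iff)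
    with n show False by simp
  qed
qed


subsection \<open>Similitudes along paths\<close>

lemma comp_maps_simps [simp]:
  "comp_maps f [] = id" "comp_maps f (e # p) = f e \<circ> comp_maps f p"
  by (simp_all add: comp_maps_def)

lemma comp_maps_append: "comp_maps f (p @ q) = comp_maps f p \<circ> comp_maps f q"
  by (induction p) (simp_all add: comp_assoc)

text \<open>After subtraction of \<open>g 0\<close> the map is linear and injective, hence onto in
  finite dimension.\<close>

lemma similitude_surj:
  fixes g :: "'a::euclidean_space \<Rightarrow> 'a"
  assumes "c \<noteq> 0" and "\<And>x y. dist (g x) (g y) = c * dist x y"
  shows "surj g"
proof -
  have lin: "linear (\<lambda>x. g x - g 0)"
    using assms(2) by (intro scaling_linear[of _ c]) (auto simp: dist_norm)
  moreover have "inj (\<lambda>x. g x - g 0)"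
  proof (rule injI)
    fix x y assume "g x - g 0 = g y - g 0"
    then show "x = y"
      using assms(1) assms(2)[of x y] by simp
  qed
  ultimately have surj: "surj (\<lambda>x. g x - g 0)"
    by (rule linear_injective_imp_surjective) simp
  have "\<exists>x. y = g x" for y
  proof -
    obtain x where "y - g 0 = g x - g 0"
      using surjD[OF surj] by blast
    then show ?thesis by auto
  qed
  then show ?thesis by (simp add: surj_def)
qed

text \<open>Takes the minimum of finitely many positive constants, \<open>P\<close> being inherited
  by smaller ones.\<close>

lemma finite_uniform_pos:
  fixes P :: "'a \<Rightarrow> real \<Rightarrow> bool"
  assumes "finite V" and "\<And>v. v \<in> V \<Longrightarrow> \<exists>e>0. P v e"
    and "\<And>v e e'. \<lbrakk>P v e; 0 < e'; e' \<le> e\<rbrakk> \<Longrightarrow> P v e'"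
  shows "\<exists>e>0. \<forall>v\<in>V. P v e"
  using assms(1,2)
proof (induction V)
  case (insert v V)
  obtain e where e: "0 < e" "P v e"
    using insert.prems by blast
  obtain e' where e': "0 < e'" "\<forall>v\<in>V. P v e'"
    using insert by blast
  have "P u (min e e')" if "u \<in> insert v V" for u
    using that e e' assms(3)[of v e "min e e'"] assms(3)[of u e' "min e e'"] by auto
  with e e' show ?case
    by (intro exI[of _ "min e e'"]) simp
qed (auto intro: exI[of _ 1])

context tiling_ifs
begin

abbreviation weight :: "nat list \<Rightarrow> nat" where
  "weight p \<equiv> sum_list (map a p)"

lemma bij_map: "bij (f e)" if "e \<in> arcs G"
proof -
  have "inj (f e)"
  proof (rule injI)
    fix x y assume "f e x = f e y"
    then show "x = y"
      using similitude[OF that, of x y] s_pos by simp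
  qed
  moreover have "surj (f e)"
    using similitude[OF that] s_pos by (intro similitude_surj[of "s ^ a e"]) auto
  ultimately show ?thesis by (rule bijI)
qed

lemma dist_comp_maps:
  "set p \<subseteq> arcs G \<Longrightarrow> dist (comp_maps f p x) (comp_maps f p y) = s ^ weight p * dist x y"
  by (induction p) (simp_all add: similitude power_add)

lemma dist_inv_comp_maps:
  "set p \<subseteq> arcs G \<Longrightarrow> dist (inv_comp_maps f p x) (inv_comp_maps f p y) = dist x y / s ^ weight p"
  unfolding inv_comp_maps_def
proof (induction p)
  case (Cons e p)
  have e: "e \<in> arcs G" using Cons.prems by simp
  have "dist (inv (f e) u) (inv (f e) v) = dist u v / s ^ a e" for u v
    using similitude[OF e, of "inv (f e) u" "inv (f e) v"] s_pos
    unfolding surj_f_inv_f[OF bij_is_surj[OF bij_map[OF e]]] by simp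
  with Cons show ?case
    by (simp add: power_add mult.commute)
qed simp

lemma inv_comp_maps_append: "inv_comp_maps f (p @ q) = inv_comp_maps f p \<circ> inv_comp_maps f q"
  by (simp add: inv_comp_maps_def comp_maps_append)

text \<open>The cancellation behind the inclusion of each stage of a tiling in the next.\<close>

lemma inv_comp_maps_snoc:
  "e \<in> arcs G \<Longrightarrow> inv_comp_maps f (p @ [e]) (f e x) = inv_comp_maps f p x"
  using bij_map[of e] by (simp add: inv_comp_maps_append) (simp add: inv_comp_maps_def bij_is_inj)

text \<open>The inverse maps stand in the order of \<open>p\<close>, so they cancel the maps of the
  reversed word from the inside out.\<close>

lemma inv_comp_maps_rev:
  "set p \<subseteq> arcs G \<Longrightarrow> inv_comp_maps f p (comp_maps f (rev p) x) = x"
proof (induction p arbitrary: x)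
  case (Cons e p)
  then show ?case
    using bij_map[of e] by (simp add: comp_maps_append inv_comp_maps_def bij_is_inj)
qed (simp add: inv_comp_maps_def)

lemma length_le_weight: "set p \<subseteq> arcs G \<Longrightarrow> length p \<le> weight p"
proof (induction p)
  case (Cons e p)
  then show ?case using a_ge_1[of e] by simp
qed simp

lemma awalk_terminal: "awalk v p w \<Longrightarrow> terminal G (v, p) = w"
  by (simp add: awalk_def terminal_eqI)

lemma awalk_end_in_verts: "awalk v p w \<Longrightarrow> w \<in> verts G"
  by (rule awalk_last_in_verts)

lemma Omega_iff:
  "(u, p) \<in> Omega G a k v \<longleftrightarrow> u = v \<and> (\<exists>w. awalk v p w) \<and> weight (butlast p) \<le> k \<and> k < weight p"
  by (auto simp: Omega_def fin_paths_def xi_def xi_minus_def initial_def edges_def)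

lemma awalk_inf_path:
  "\<sigma> \<in> inf_paths G \<Longrightarrow> awalk (tail G (\<sigma> i)) (map \<sigma> [i..<i + k]) (tail G (\<sigma> (i + k)))"
  using inf_paths_cas[of \<sigma> G i k] by (auto simp: awalk_def inf_paths_arcs)


subsection \<open>Attractors\<close>

text \<open>With \<open>C\<close> bounding all \<open>norm (f e 0)\<close>, the number B = C / (1 -
  s) solves s B + C = B, so the bound survives each further map.\<close>

lemma exists_orbit_bound: "\<exists>B. \<forall>p. set p \<subseteq> arcs G \<longrightarrow> norm (comp_maps f p 0) \<le> B"
proof -
  define C where "C = Max (insert 0 ((\<lambda>e. norm (f e 0)) ` arcs G))"
  have C: "norm (f e 0) \<le> C" if "e \<in> arcs G" for e
    using that unfolding C_def by (intro Max_ge) auto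
  have C0: "0 \<le> C"
    unfolding C_def by (intro Max_ge) auto
  have "norm (comp_maps f p 0) \<le> C / (1 - s)" if "set p \<subseteq> arcs G" for p
    using that
  proof (induction p)
    case (Cons e p)
    have e: "e \<in> arcs G" using Cons by simp
    have "norm (f e (comp_maps f p 0)) \<le> dist (f e (comp_maps f p 0)) (f e 0) + norm (f e 0)"
      by (simp add: dist_norm norm_triangle_sub add.commute)
    also have "\<dots> \<le> s ^ a e * norm (comp_maps f p 0) + C"
      using C[OF e] by (simp add: similitude[OF e])
    also have "s ^ a e * norm (comp_maps f p 0) \<le> s ^ 1 * (C / (1 - s))"
      using s_pos s_less_1 a_ge_1[OF e] Cons by (intro mult_mono power_decreasing) auto
    also have "s ^ 1 * (C / (1 - s)) + C = C / (1 - s)"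
      using s_less_1 by (simp add: field_simps)
    finally show ?case by simp
  qed (use C0 s_less_1 in simp)
  then show ?thesis
    by blast
qed

text \<open>One fixed constant, which also bounds addresses and attractors.\<close>

definition orbit_bound :: real where
  "orbit_bound = (SOME B. \<forall>p. set p \<subseteq> arcs G \<longrightarrow> norm (comp_maps f p 0) \<le> B)"

lemma norm_comp_maps_0_le: "set p \<subseteq> arcs G \<Longrightarrow> norm (comp_maps f p 0) \<le> orbit_bound"
  using someI_ex[OF exists_orbit_bound] unfolding orbit_bound_def by blast+

text \<open>The common prefix of length \<open>k\<close> contracts at least by the factor
  \<open>s ^ k\<close>, because every weight is at least 1.\<close>

lemma comp_maps_prefix_dist:
  assumes "\<And>k. \<sigma> k \<in> arcs G"
  shows "dist (comp_maps f (map \<sigma> [0..<k]) 0) (comp_maps f (map \<sigma> [0..<k + j]) 0)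
    \<le> s ^ k * orbit_bound"
proof -
  let ?p = "map \<sigma> [0..<k]" and ?q = "map \<sigma> [k..<k + j]"
  have arcs: "set ?p \<subseteq> arcs G" "set ?q \<subseteq> arcs G"
    using assms by auto
  have "map \<sigma> [0..<k + j] = ?p @ ?q"
    by (metis le_add1 le_add_same_cancel1 map_append upt_add_eq_append)
  then have "dist (comp_maps f ?p 0) (comp_maps f (map \<sigma> [0..<k + j]) 0)
      = s ^ weight ?p * norm (comp_maps f ?q 0)"
    using dist_comp_maps[OF arcs(1), of 0 "comp_maps f ?q 0"] by (simp add: comp_maps_append)
  also have "\<dots> \<le> s ^ k * orbit_bound"
    using s_pos s_less_1 length_le_weight[OF arcs(1)] norm_comp_maps_0_le[OF arcs(2)]
    by (intro mult_mono power_decreasing) auto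
  finally show ?thesis .
qed

lemma power_orbit_bound_tendsto_0: "(\<lambda>k. s ^ k * orbit_bound) \<longlonglongrightarrow> 0"
  using s_pos s_less_1 by (intro tendsto_mult_left_zero LIMSEQ_power_zero) simp

lemma address_tendsto:
  assumes "\<And>k. \<sigma> k \<in> arcs G"
  shows "(\<lambda>k. comp_maps f (map \<sigma> [0..<k]) 0) \<longlonglongrightarrow> address f \<sigma>"
proof -
  let ?c = "\<lambda>k. comp_maps f (map \<sigma> [0..<k]) 0"
  have "Cauchy ?c"
  proof (rule metric_CauchyI)
    fix e :: real assume "0 < e"
    then have "\<forall>\<^sub>F k in sequentially. s ^ k * orbit_bound < e / 2"
      using power_orbit_bound_tendsto_0 by (intro order_tendstoD) auto
    then obtain k where k: "s ^ k * orbit_bound < e / 2"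
      by (auto simp: eventually_sequentially)
    have "dist (?c k) (?c m) < e / 2" if "m \<ge> k" for m
      using comp_maps_prefix_dist[of \<sigma> k "m - k", OF assms] k that by simp
    then show "\<exists>k. \<forall>m\<ge>k. \<forall>n\<ge>k. dist (?c m) (?c n) < e"
      by (metis dist_commute dist_triangle_half_r)
  qed
  then show ?thesis
    unfolding address_def by (simp add: Cauchy_convergent_iff convergent_LIMSEQ_iff)
qed

lemma dist_address_le:
  assumes "\<And>k. \<sigma> k \<in> arcs G"
  shows "dist (comp_maps f (map \<sigma> [0..<k]) 0) (address f \<sigma>) \<le> s ^ k * orbit_bound"
proof (rule LIMSEQ_le_const2)
  let ?c = "\<lambda>k. comp_maps f (map \<sigma> [0..<k]) 0"
  show "(\<lambda>j. dist (?c k) (?c (k + j))) \<longlonglongrightarrow> dist (?c k) (address f \<sigma>)"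
    using LIMSEQ_ignore_initial_segment[OF address_tendsto[of \<sigma>, OF assms], of k]
    by (intro tendsto_intros) (simp add: add.commute)
  show "\<exists>N. \<forall>j\<ge>N. dist (?c k) (?c (k + j)) \<le> s ^ k * orbit_bound"
    using comp_maps_prefix_dist[of \<sigma>, OF assms] by blast
qed

lemma norm_address_le: "(\<And>k. \<sigma> k \<in> arcs G) \<Longrightarrow> norm (address f \<sigma>) \<le> orbit_bound"
  using dist_address_le[of \<sigma> 0] by simp

text \<open>The similitude along the prefix is continuous and so passes through the limit.\<close>

lemma address_prefix:
  assumes "\<And>k. \<sigma> k \<in> arcs G"
  shows "address f \<sigma> = comp_maps f (map \<sigma> [0..<k]) (address f (\<lambda>i. \<sigma> (k + i)))"
proof (rule LIMSEQ_unique)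
  let ?c = "\<lambda>k. comp_maps f (map \<sigma> [0..<k]) 0"
  let ?\<tau> = "\<lambda>i. \<sigma> (k + i)" and ?g = "comp_maps f (map \<sigma> [0..<k])"
  show "(\<lambda>j. ?c (j + k)) \<longlonglongrightarrow> address f \<sigma>"
    using LIMSEQ_ignore_initial_segment[OF address_tendsto[of \<sigma>, OF assms], of k] by simp
  have arcs: "set (map \<sigma> [0..<k]) \<subseteq> arcs G"
    using assms by auto
  have "map \<sigma> [0..<j + k] = map \<sigma> [0..<k] @ map ?\<tau> [0..<j]" for j
  proof -
    have "[0..<j + k] = [0..<k] @ [k..<j + k]"
      by (metis add.commute le_add1 le_add_same_cancel1 upt_add_eq_append)
    moreover have "[k..<j + k] = map (\<lambda>i. k + i) [0..<j]"
      by (simp add: map_add_upt add.commute)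
    ultimately show ?thesis by simp
  qed
  then have *: "?c (j + k) = ?g (comp_maps f (map ?\<tau> [0..<j]) 0)" for j
    by (simp add: comp_maps_append)
  have "(\<lambda>j. comp_maps f (map ?\<tau> [0..<j]) 0) \<longlonglongrightarrow> address f ?\<tau>"
    using assms by (intro address_tendsto)
  then have "(\<lambda>j. s ^ weight (map \<sigma> [0..<k]) * dist (comp_maps f (map ?\<tau> [0..<j]) 0) (address f ?\<tau>))
      \<longlonglongrightarrow> 0"
    by (intro tendsto_mult_right_zero) (simp add: tendsto_dist_iff[symmetric])
  then have "(\<lambda>j. dist (?c (j + k)) (?g (address f ?\<tau>))) \<longlonglongrightarrow> 0"
    unfolding * dist_comp_maps[OF arcs] .
  then show "(\<lambda>j. ?c (j + k)) \<longlonglongrightarrow> ?g (address f ?\<tau>)"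
    by (simp add: tendsto_dist_iff[symmetric])
qed

end

section \<open>Compactness of the space of edge sequences\<close>

lemma open_coordinate: "open {\<sigma> :: nat \<Rightarrow> nat. \<sigma> i = n}"
proof -
  have "open ((\<lambda>\<sigma> :: nat \<Rightarrow> nat. \<sigma> i) -` {n})"
    by (intro open_vimage) (auto intro: continuous_on_product_coordinates open_discrete)
  then show ?thesis by (simp add: vimage_def)
qed

text \<open>Coordinates take values in a discrete space, so the complement is a union of open
  cylinders.\<close>

lemma closed_coordinates: "closed {\<sigma> :: nat \<Rightarrow> nat. Q (\<sigma> i) (\<sigma> j)}"
proof -
  have "open (\<Union>(m, n)\<in>{(m, n). \<not> Q m n}. {\<sigma> :: nat \<Rightarrow> nat. \<sigma> i = m} \<inter> {\<sigma>. \<sigma> j = n})"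
    by (intro open_UN ballI) (auto intro: open_coordinate)
  also have "(\<Union>(m, n)\<in>{(m, n). \<not> Q m n}. {\<sigma> :: nat \<Rightarrow> nat. \<sigma> i = m} \<inter> {\<sigma>. \<sigma> j = n})
      = - {\<sigma>. Q (\<sigma> i) (\<sigma> j)}"
    by auto
  finally show ?thesis by (simp add: closed_def)
qed

lemma compact_sequences:
  fixes E :: "nat set"
  assumes "finite E"
  shows "compact {\<sigma> :: nat \<Rightarrow> nat. \<forall>k. \<sigma> k \<in> E}"
proof -
  have "compactin (product_topology (\<lambda>_ :: nat. euclidean :: nat topology) UNIV) (PiE UNIV (\<lambda>_. E))"
    using assms by (auto simp: compactin_PiE finite_imp_compact)
  then show ?thesis
    by (simp add: euclidean_product_topology PiE_UNIV_domain Pi_def)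
qed

context tiling_ifs
begin

text \<open>The approximants depend on finitely many coordinates, hence are locally constant, and
  they converge uniformly.\<close>

lemma continuous_on_address: "continuous_on {\<sigma>. \<forall>k. \<sigma> k \<in> arcs G} (address f)"
proof (rule uniform_limit_theorem)
  let ?S = "{\<sigma> :: nat \<Rightarrow> nat. \<forall>k. \<sigma> k \<in> arcs G}"
  show "\<forall>\<^sub>F k in sequentially. continuous_on ?S (\<lambda>\<sigma>. comp_maps f (map \<sigma> [0..<k]) 0)"
  proof (rule always_eventually, rule allI)
    fix k
    show "continuous_on ?S (\<lambda>\<sigma>. comp_maps f (map \<sigma> [0..<k]) 0)"
      unfolding continuous_on_topological
    proof (intro ballI allI impI)
      fix \<sigma> B assume B: "comp_maps f (map \<sigma> [0..<k]) 0 \<in> B"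
      let ?A = "\<Inter>i\<in>{..<k}. {\<tau>. \<tau> i = \<sigma> i}"
      have "open ?A"
        by (intro open_INT) (auto intro: open_coordinate)
      moreover have "comp_maps f (map \<tau> [0..<k]) 0 \<in> B" if "\<tau> \<in> ?A" for \<tau>
      proof -
        have "map \<tau> [0..<k] = map \<sigma> [0..<k]" using that by auto
        with B show ?thesis by metis
      qed
      ultimately show "\<exists>A. open A \<and> \<sigma> \<in> A \<and>
          (\<forall>\<tau>\<in>?S. \<tau> \<in> A \<longrightarrow> comp_maps f (map \<tau> [0..<k]) 0 \<in> B)"
        by (intro exI[of _ ?A]) auto
    qed
  qed
  show "uniform_limit ?S (\<lambda>k \<sigma>. comp_maps f (map \<sigma> [0..<k]) 0) (address f) sequentially"
  proof (rule uniform_limitI)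
    fix e :: real assume "0 < e"
    then have "\<forall>\<^sub>F k in sequentially. s ^ k * orbit_bound < e"
      using power_orbit_bound_tendsto_0 by (intro order_tendstoD) auto
    then show "\<forall>\<^sub>F k in sequentially. \<forall>\<sigma>\<in>?S.
        dist (comp_maps f (map \<sigma> [0..<k]) 0) (address f \<sigma>) < e"
      by eventually_elim (use dist_address_le in \<open>fastforce intro: order_le_less_trans\<close>)
  qed
qed simp

text \<open>The attractor is the continuous image of the admissible sequences, which form a closed
  subset of a compact space.\<close>

lemma compact_attractor: "compact (attractor G f v)"
proof -
  let ?S = "{\<sigma> :: nat \<Rightarrow> nat. \<forall>k. \<sigma> k \<in> arcs G}"
  let ?K = "?S \<inter> ((\<Inter>k. {\<sigma>. head G (\<sigma> k) = tail G (\<sigma> (Suc k))}) \<inter> {\<sigma>. tail G (\<sigma> 0) = v})"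
  have "compact ?K"
    using closed_coordinates[of "\<lambda>m n. head G m = tail G n"] closed_coordinates[of "\<lambda>m n. tail G m = v" 0]
    by (intro compact_Int_closed compact_sequences closed_Int closed_INT) auto
  then have "compact (address f ` ?K)"
    by (intro compact_continuous_image continuous_on_subset[OF continuous_on_address]) auto
  also have "address f ` ?K = attractor G f v"
    by (auto simp: attractor_def inf_paths_def inf_initial_def)
  finally show ?thesis .
qed

lemma norm_attractor_le: "x \<in> attractor G f v \<Longrightarrow> norm x \<le> orbit_bound"
  using norm_address_le inf_paths_arcs[of _ G] by (fastforce simp: attractor_def)

lemma attractor_ne: "v \<in> verts G \<Longrightarrow> attractor G f v \<noteq> {}"
  using attractors_span[of v] by auto

text \<open>A single point is its own affine hull, while the space contains the distinct points 0
  and 1.\<close>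

lemma attractor_two_points:
  assumes "v \<in> verts G"
  shows "\<exists>x\<in>attractor G f v. \<exists>y\<in>attractor G f v. x \<noteq> y"
proof (rule ccontr)
  assume "\<not> ?thesis"
  then obtain x where "attractor G f v = {x}"
    using attractor_ne[OF assms] by blast
  then have "(UNIV :: (real^'m) set) = {x}"
    using attractors_span[OF assms] by simp
  then show False
    by (metis UNIV_I singletonD zero_neq_one)
qed

text \<open>Expanding such a pair will force some tile far from the origin.\<close>

lemma attractor_spread: "\<exists>\<eta>>0. \<forall>v\<in>verts G. \<exists>x\<in>attractor G f v. \<exists>y\<in>attractor G f v. \<eta> \<le> dist x y"
proof (rule finite_uniform_pos)
  fix v assume "v \<in> verts G"
  then obtain x y where "x \<in> attractor G f v" "y \<in> attractor G f v" "x \<noteq> y"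
    using attractor_two_points by blast
  then show "\<exists>\<eta>>0. \<exists>x\<in>attractor G f v. \<exists>y\<in>attractor G f v. \<eta> \<le> dist x y"
    by (intro exI[of _ "dist x y"]) auto
next
  fix v and \<eta> \<eta>' :: real
  assume "\<exists>x\<in>attractor G f v. \<exists>y\<in>attractor G f v. \<eta> \<le> dist x y" "\<eta>' \<le> \<eta>"
  then show "\<exists>x\<in>attractor G f v. \<exists>y\<in>attractor G f v. \<eta>' \<le> dist x y"
    by (meson order_trans)
qed simp

text \<open>An address of \<open>x\<close> is cut at the first length whose weight exceeds
  \<open>k\<close>. Hence the tiles coded by \<open>Omega G a k v\<close> cover the attractor at
  \<open>v\<close>.\<close>

lemma attractor_cover:
  assumes "x \<in> attractor G f v"
  shows "\<exists>p w. awalk v p w \<and> weight (butlast p) \<le> k \<and> k < weight p \<and> x \<in> comp_maps f p ` attractor G f w"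
proof -
  obtain \<sigma> where \<sigma>: "\<sigma> \<in> inf_paths G" "tail G (\<sigma> 0) = v" "x = address f \<sigma>"
    using assms by (auto simp: attractor_def inf_initial_def)
  have arcs: "\<sigma> i \<in> arcs G" for i using \<sigma>(1) by (rule inf_paths_arcs)
  define n where "n = (LEAST n. k < weight (map \<sigma> [0..<n]))"
  have "k < weight (map \<sigma> [0..<Suc k])"
    using length_le_weight[of "map \<sigma> [0..<Suc k]"] arcs by fastforce
  then have n: "k < weight (map \<sigma> [0..<n])"
    unfolding n_def by (rule LeastI)
  \<comment> \<open>The empty prefix has weight 0, so the cut comes after at least one edge, and
    minimality bounds the weight of the edges before the last.\<close>
  then obtain m where m: "n = Suc m"
    by (cases n) auto
  then have "\<not> k < weight (map \<sigma> [0..<m])"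
    using not_less_Least[of m "\<lambda>n. k < weight (map \<sigma> [0..<n])"] unfolding n_def by simp
  then have "weight (butlast (map \<sigma> [0..<n])) \<le> k"
    by (simp add: m butlast_append)
  moreover have "awalk v (map \<sigma> [0..<n]) (tail G (\<sigma> n))"
    using awalk_inf_path[OF \<sigma>(1), of 0 n] \<sigma>(2) by simp
  moreover have "x \<in> comp_maps f (map \<sigma> [0..<n]) ` attractor G f (tail G (\<sigma> n))"
    unfolding \<sigma>(3) address_prefix[of \<sigma> n, OF arcs] attractor_def inf_initial_def
    using inf_paths_shift[OF \<sigma>(1), of n] by (intro imageI CollectI exI[of _ "\<lambda>i. \<sigma> (n + i)"]) auto
  ultimately show ?thesis
    using n by blast
qed


subsection \<open>Tilings\<close>

text \<open>Keeps the map and the end vertex rather than the tile, since the open set condition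
  separates images of the sets \<open>U w\<close> under these maps, and a tile as a set does not
  display them.\<close>

definition pieces :: "nat list \<Rightarrow> 'v \<Rightarrow> ((real^'m \<Rightarrow> real^'m) \<times> 'v) set" where
  "pieces es v = {(inv_comp_maps f es \<circ> comp_maps f p, w) | p w.
     awalk v p w \<and> weight (butlast p) \<le> weight es \<and> weight es < weight p}"

definition piece_tile :: "(real^'m \<Rightarrow> real^'m) \<times> 'v \<Rightarrow> (real^'m) set" where
  "piece_tile q = fst q ` attractor G f (snd q)"

lemma piecesI:
  assumes "awalk v p w" "weight (butlast p) \<le> weight es" "weight es < weight p"
  shows "(inv_comp_maps f es \<circ> comp_maps f p, w) \<in> pieces es v"
  using assms unfolding pieces_def by blast

lemma piecesE:
  assumes "q \<in> pieces es v"
  obtains p w where "q = (inv_comp_maps f es \<circ> comp_maps f p, w)" "awalk v p w"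
    "weight (butlast p) \<le> weight es" "weight es < weight p"
  using assms unfolding pieces_def by blast

lemma fin_tiling_eq:
  "fin_tiling G f a (u, es) = piece_tile ` pieces es (terminal (reverse_digraph G) (u, es))"
proof -
  let ?v = "terminal (reverse_digraph G) (u, es)"
  have tile: "inv_comp_maps f es ` tile G f (v, p) = piece_tile (inv_comp_maps f es \<circ> comp_maps f p, w)"
    if "awalk v p w" for v p w
    using awalk_terminal[OF that] by (simp add: tile_def piece_tile_def edges_def image_comp comp_def)
  show ?thesis
  proof (intro set_eqI iffI)
    fix t assume "t \<in> fin_tiling G f a (u, es)"
    then obtain v p where p: "(v, p) \<in> Omega G a (weight es) ?v"
      "t = inv_comp_maps f es ` tile G f (v, p)"
      by (auto simp: fin_tiling_def xi_def edges_def)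
    from p(1) obtain w where w: "v = ?v" "awalk ?v p w"
      "weight (butlast p) \<le> weight es" "weight es < weight p"
      unfolding Omega_iff by auto
    have "t = piece_tile (inv_comp_maps f es \<circ> comp_maps f p, w)"
      unfolding p(2) w(1) by (rule tile[OF w(2)])
    then show "t \<in> piece_tile ` pieces es ?v"
      using piecesI[OF w(2-4)] by (rule image_eqI)
  next
    fix t assume "t \<in> piece_tile ` pieces es ?v"
    then obtain q where q: "q \<in> pieces es ?v" "t = piece_tile q" by blast
    from q(1) show "t \<in> fin_tiling G f a (u, es)"
    proof (rule piecesE)
      fix p w
      assume *: "q = (inv_comp_maps f es \<circ> comp_maps f p, w)" "awalk ?v p w"
        "weight (butlast p) \<le> weight es" "weight es < weight p"
      then have "(?v, p) \<in> Omega G a (weight es) ?v"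
        unfolding Omega_iff by blast
      moreover have "t = inv_comp_maps f es ` tile G f (?v, p)"
        unfolding q(2) *(1) by (rule tile[OF *(2), symmetric])
      ultimately show ?thesis
        unfolding fin_tiling_def xi_def edges_def by auto
    qed
  qed
qed

lemma weight_butlast: "p \<noteq> [] \<Longrightarrow> weight p = weight (butlast p) + a (last p)"
  by (subst append_butlast_last_id[symmetric], assumption) (simp del: append_butlast_last_id)

lemma pieces_end_in_verts: "q \<in> pieces es v \<Longrightarrow> snd q \<in> verts G"
  by (erule piecesE) (auto dest: awalk_end_in_verts)

definition min_scale :: real where
  "min_scale = s ^ Max (a ` arcs G)"

lemma min_scale_pos: "0 < min_scale"
  using s_pos by (simp add: min_scale_def)

text \<open>The weight of \<open>p\<close> passes that of \<open>es\<close> only with its last edge,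
  so the difference of the weights lies between 1 and the largest \<open>a e\<close>.\<close>

lemma pieces_similitude:
  assumes q: "q \<in> pieces es v" and es: "set es \<subseteq> arcs G"
  shows "\<exists>c. min_scale \<le> c \<and> c \<le> 1 \<and> (\<forall>x y. dist (fst q x) (fst q y) = c * dist x y)"
  using q
proof (rule piecesE)
  fix p w
  assume q: "q = (inv_comp_maps f es \<circ> comp_maps f p, w)" and p: "awalk v p w"
    and "weight (butlast p) \<le> weight es" and less: "weight es < weight p"
  then have "p \<noteq> []" by auto
  have arcs: "set p \<subseteq> arcs G" using p by (simp add: awalk_def)
  then have "last p \<in> arcs G"
    using \<open>p \<noteq> []\<close> last_in_set by blast
  then have "a (last p) \<le> Max (a ` arcs G)"
    by simp
  then have le: "weight p - weight es \<le> Max (a ` arcs G)"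
    using weight_butlast[OF \<open>p \<noteq> []\<close>] \<open>weight (butlast p) \<le> weight es\<close> by linarith
  let ?c = "s ^ (weight p - weight es)"
  have "dist (fst q x) (fst q y) = ?c * dist x y" for x y
    using less s_pos
    by (simp add: q dist_inv_comp_maps[OF es] dist_comp_maps[OF arcs] power_diff)
  moreover have "min_scale \<le> ?c"
    unfolding min_scale_def using le s_pos s_less_1 by (intro power_decreasing) auto
  moreover have "?c \<le> 1"
    using s_pos s_less_1 by (intro power_le_one) auto
  ultimately show ?thesis by blast
qed

text \<open>Every edge weighs at least 1, so the bound on the weight of \<open>butlast p\<close>
  bounds the length of \<open>p\<close>.\<close>

lemma finite_pieces: "finite (pieces es v)"
proof -
  let ?P = "{p. set p \<subseteq> arcs G \<and> length p \<le> Suc (weight es)}"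
  have "pieces es v \<subseteq> (\<lambda>(p, w). (inv_comp_maps f es \<circ> comp_maps f p, w)) ` (?P \<times> verts G)"
  proof
    fix q assume "q \<in> pieces es v"
    then show "q \<in> (\<lambda>(p, w). (inv_comp_maps f es \<circ> comp_maps f p, w)) ` (?P \<times> verts G)"
    proof (rule piecesE)
      fix p w
      assume q: "q = (inv_comp_maps f es \<circ> comp_maps f p, w)" and p: "awalk v p w"
        and le: "weight (butlast p) \<le> weight es"
      have arcs: "set p \<subseteq> arcs G" using p by (simp add: awalk_def)
      then have "set (butlast p) \<subseteq> arcs G"
        by (meson in_set_butlastD subset_iff)
      then have "length (butlast p) \<le> weight es"
        using length_le_weight le order_trans by blast
      then have "(p, w) \<in> ?P \<times> verts G"
        using arcs awalk_end_in_verts[OF p] by auto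
      then show ?thesis
        unfolding q by (intro image_eqI[of _ _ "(p, w)"]) auto
    qed
  qed
  moreover have "finite (?P \<times> verts G)"
    by (simp add: finite_lists_length_le)
  ultimately show ?thesis
    by (meson finite_imageI finite_subset)
qed

lemma pieces_ne: "v \<in> verts G \<Longrightarrow> pieces es v \<noteq> {}"
  using attractor_ne attractor_cover piecesI by (metis empty_iff equals0I)

section \<open>Separation of pieces by the open set condition\<close>

lemma awalk_image_subset:
  assumes "\<And>e. e \<in> arcs G \<Longrightarrow> f e ` U (head G e) \<subseteq> U (tail G e)"
  shows "awalk v p w \<Longrightarrow> comp_maps f p ` U w \<subseteq> U v"
proof (induction p arbitrary: v)
  case (Cons e p)
  then have "comp_maps f p ` U w \<subseteq> U (head G e)" "e \<in> arcs G" "v = tail G e"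
    by (auto simp: awalk_Cons_iff)
  then show ?case
    using assms[of e] by (auto simp: image_subset_iff)
qed (simp add: awalk_def pre_digraph.cas.simps)

text \<open>Common leading edges act injectively and can be stripped; where the walks part, the open
  set condition separates them.\<close>

lemma awalk_images_disjoint:
  assumes U: "\<And>e. e \<in> arcs G \<Longrightarrow> f e ` U (head G e) \<subseteq> U (tail G e)"
    and disj: "\<And>e d. \<lbrakk>e \<in> arcs G; d \<in> arcs G; d \<noteq> e; tail G d = tail G e\<rbrakk>
      \<Longrightarrow> f e ` U (head G e) \<inter> f d ` U (head G d) = {}"
  shows "\<lbrakk>awalk v p w; awalk v q w'; \<not> prefix p q; \<not> prefix q p\<rbrakk>
    \<Longrightarrow> comp_maps f p ` U w \<inter> comp_maps f q ` U w' = {}"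
proof (induction p arbitrary: v q)
  case (Cons e p)
  then obtain d q' where q: "q = d # q'" by (cases q) auto
  have e: "e \<in> arcs G" "tail G e = v" "awalk (head G e) p w"
    and d: "d \<in> arcs G" "tail G d = v" "awalk (head G d) q' w'"
    using Cons.prems by (auto simp: awalk_Cons_iff q)
  show ?case
  proof (cases "e = d")
    case True
    then have "comp_maps f p ` U w \<inter> comp_maps f q' ` U w' = {}"
      using Cons.prems e d by (intro Cons.IH[of "head G e"]) (auto simp: q)
    moreover have "inj (f e)"
      using bij_map[OF e(1)] by (rule bij_is_inj)
    ultimately have "f e ` comp_maps f p ` U w \<inter> f e ` comp_maps f q' ` U w' = {}"
      by (metis image_Int image_empty)
    then show ?thesis
      by (simp add: q True image_comp)
  next
    case False
    have "comp_maps f p ` U w \<subseteq> U (head G e)" "comp_maps f q' ` U w' \<subseteq> U (head G d)"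
      using awalk_image_subset[of U, OF U] e(3) d(3) by blast+
    then have "comp_maps f (e # p) ` U w \<subseteq> f e ` U (head G e)"
      "comp_maps f q ` U w' \<subseteq> f d ` U (head G d)"
      by (auto simp: q)
    then show ?thesis
      using disj[OF e(1) d(1)] False e(2) d(2) by blast
  qed
qed simp

text \<open>A proper extension \<open>q\<close> of \<open>p\<close> has all of \<open>p\<close>
  inside \<open>butlast q\<close>, whose weight would then exceed \<open>k\<close>.\<close>

lemma prefix_weight_eq:
  assumes "prefix p q" "weight (butlast q) \<le> k" "k < weight p"
  shows "p = q"
proof (rule ccontr)
  assume "p \<noteq> q"
  then obtain r where "q = p @ r" "r \<noteq> []"
    using assms(1) by (auto simp: prefix_def)
  then have "weight p \<le> weight (butlast q)"
    by (simp add: butlast_append)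
  with assms show False by simp
qed

lemma pieces_disjoint:
  assumes U: "\<And>e. e \<in> arcs G \<Longrightarrow> f e ` U (head G e) \<subseteq> U (tail G e)"
    and disj: "\<And>e d. \<lbrakk>e \<in> arcs G; d \<in> arcs G; d \<noteq> e; tail G d = tail G e\<rbrakk>
      \<Longrightarrow> f e ` U (head G e) \<inter> f d ` U (head G d) = {}"
    and q: "q \<in> pieces es v" "q' \<in> pieces es v" "q \<noteq> q'" and es: "set es \<subseteq> arcs G"
  shows "fst q ` U (snd q) \<inter> fst q' ` U (snd q') = {}"
proof -
  obtain p w where p: "q = (inv_comp_maps f es \<circ> comp_maps f p, w)" "awalk v p w"
    "weight (butlast p) \<le> weight es" "weight es < weight p"
    using q(1) by (rule piecesE)
  obtain p' w' where p': "q' = (inv_comp_maps f es \<circ> comp_maps f p', w')" "awalk v p' w'"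
    "weight (butlast p') \<le> weight es" "weight es < weight p'"
    using q(2) by (rule piecesE)
  \<comment> \<open>A walk determines its end vertex, so equal walks would give equal
    pieces.\<close>
  have "p \<noteq> p'"
    using awalk_terminal[OF p(2)] awalk_terminal[OF p'(2)] q(3) p(1) p'(1) by auto
  then have "\<not> prefix p p'" "\<not> prefix p' p"
    using prefix_weight_eq[of p p' "weight es"] prefix_weight_eq[of p' p "weight es"] p p' by auto
  then have "comp_maps f p ` U w \<inter> comp_maps f p' ` U w' = {}"
    using awalk_images_disjoint[of U, OF U disj p(2) p'(2)] by blast
  moreover have "inj (inv_comp_maps f es)"
  proof (rule injI)
    fix x y assume "inv_comp_maps f es x = inv_comp_maps f es y"
    then show "x = y"
      using dist_inv_comp_maps[OF es, of x y] s_pos by simp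
  qed
  ultimately have "inv_comp_maps f es ` comp_maps f p ` U w \<inter> inv_comp_maps f es ` comp_maps f p' ` U w' = {}"
    by (metis image_Int image_empty)
  then show ?thesis
    by (simp add: p(1) p'(1) image_comp)
qed

text \<open>Each piece contains a ball of a fixed radius around the image of a chosen point of its open
  set. The balls are disjoint, so the centres are uniformly separated.\<close>

lemma finite_pieces_meeting_cball:
  assumes U: "\<And>v. v \<in> verts G \<Longrightarrow> U v \<noteq> {}" "\<And>v. v \<in> verts G \<Longrightarrow> open (U v)"
    and verts: "\<And>q. q \<in> Q \<Longrightarrow> snd q \<in> verts G"
    and sim: "\<And>q. q \<in> Q \<Longrightarrow>
      \<exists>c. min_scale \<le> c \<and> c \<le> 1 \<and> (\<forall>x y. dist (fst q x) (fst q y) = c * dist x y)"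
    and disj: "\<And>q q'. \<lbrakk>q \<in> Q; q' \<in> Q; q \<noteq> q'\<rbrakk> \<Longrightarrow> fst q ` U (snd q) \<inter> fst q' ` U (snd q') = {}"
  shows "finite {q \<in> Q. piece_tile q \<inter> cball 0 R \<noteq> {}}"
proof -
  define u where "u v = (SOME x. x \<in> U v)" for v
  have u: "u v \<in> U v" if "v \<in> verts G" for v
    unfolding u_def using U(1)[OF that] by (simp add: some_in_eq)
  have "\<exists>r>0. \<forall>v\<in>verts G. ball (u v) r \<subseteq> U v"
  proof (rule finite_uniform_pos)
    show "\<exists>r>0. ball (u v) r \<subseteq> U v" if "v \<in> verts G" for v
      using U(2)[OF that] u[OF that] openE by metis
    show "ball (u v) r' \<subseteq> U v" if "ball (u v) r \<subseteq> U v" "r' \<le> r" for v r r'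
      using that subset_ball by blast
  qed simp
  then obtain r where r: "0 < r" "\<And>v. v \<in> verts G \<Longrightarrow> ball (u v) r \<subseteq> U v"
    by blast
  define h where "h q = fst q (u (snd q))" for q :: "(real^'m \<Rightarrow> real^'m) \<times> 'v"
  \<comment> \<open>\<open>fst q\<close> carries the ball of radius \<open>r\<close> about
    \<open>u (snd q)\<close> onto a ball of radius at least \<open>min_scale * r\<close> about
    \<open>h q\<close>. If \<open>h q'\<close> were closer than that, its preimage under
    \<open>fst q\<close> would lie in \<open>U (snd q)\<close>.\<close>
  have sep: "min_scale * r \<le> dist (h q) (h q')" if q: "q \<in> Q" "q' \<in> Q" "q \<noteq> q'" for q q'
  proof (rule ccontr)
    assume "\<not> ?thesis"
    then have less: "dist (h q) (h q') < min_scale * r" by simp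
    obtain c where c: "min_scale \<le> c" "\<And>x y. dist (fst q x) (fst q y) = c * dist x y"
      using sim[OF q(1)] by blast
    have "c > 0" using c(1) min_scale_pos by simp
    then have "surj (fst q)"
      using c(2) by (intro similitude_surj[of c]) auto
    then obtain z where z: "h q' = fst q z"
      by (metis surjD)
    have "c * dist (u (snd q)) z < min_scale * r"
      using less unfolding h_def[of q] z c(2) .
    also have "\<dots> \<le> c * r"
      using c(1) r(1) by (intro mult_right_mono) auto
    finally have "z \<in> ball (u (snd q)) r"
      using \<open>c > 0\<close> by simp
    then have "h q' \<in> fst q ` U (snd q)"
      using r(2)[OF verts[OF q(1)]] z by blast
    moreover have "h q' \<in> fst q' ` U (snd q')"
      unfolding h_def using u[OF verts[OF q(2)]] by blast
    ultimately show False
      using disj[OF q] by blast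
  qed
  have sep_pos: "0 < min_scale * r"
    using min_scale_pos r(1) by simp
  let ?Q = "{q \<in> Q. piece_tile q \<inter> cball 0 R \<noteq> {}}"
  have inj: "inj_on h ?Q"
  proof (rule inj_onI)
    fix q q' assume "q \<in> ?Q" "q' \<in> ?Q" "h q = h q'"
    then show "q = q'" using sep[of q q'] sep_pos by auto
  qed
  define B where "B = Max ((norm \<circ> u) ` verts G)"
  have B: "norm (u v) \<le> B" if "v \<in> verts G" for v
    unfolding B_def using that by (intro Max_ge) auto
  \<comment> \<open>The map of a piece does not increase distances, so the centre is at most
    \<open>orbit_bound + B\<close> away from a point of the tile inside the ball.\<close>
  have "norm (h q) \<le> R + (orbit_bound + B)" if q: "q \<in> ?Q" for q
  proof -
    obtain y where "y \<in> piece_tile q" "norm y \<le> R"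
      using q mem_cball_0 by blast
    then obtain x where x: "x \<in> attractor G f (snd q)" "norm (fst q x) \<le> R"
      unfolding piece_tile_def by blast
    obtain c where c: "min_scale \<le> c" "c \<le> 1" "dist (fst q x) (h q) = c * dist x (u (snd q))"
      using sim[of q] q unfolding h_def by blast
    have "dist (fst q x) (h q) \<le> 1 * dist x (u (snd q))"
      unfolding c(3) using c(2) by (intro mult_right_mono) auto
    also have "\<dots> \<le> norm x + norm (u (snd q))"
      by (simp add: dist_norm norm_triangle_ineq4)
    also have "\<dots> \<le> orbit_bound + B"
      using norm_attractor_le[OF x(1)] B[OF verts[of q]] that by simp
    finally show ?thesis
      using x(2) norm_triangle_sub[of "h q" "fst q x"] by (simp add: dist_norm norm_minus_commute)
  qed
  then have "bounded (h ` ?Q)"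
    unfolding bounded_iff by blast
  moreover have "\<not> x islimpt h ` ?Q" for x
  proof
    assume "x islimpt h ` ?Q"
    then have lim: "\<exists>y\<in>h ` ?Q. y \<noteq> x \<and> dist y x < e" if "e > 0" for e
      using that unfolding islimpt_approachable by blast
    obtain y where y: "y \<in> h ` ?Q" "y \<noteq> x" "dist y x < min_scale * r / 2"
      using lim[OF half_gt_zero[OF sep_pos]] by blast
    \<comment> \<open>Taking \<open>z\<close> closer to \<open>x\<close> than \<open>y\<close> makes
      the two centres distinct, with both within half the separation of \<open>x\<close>.\<close>
    obtain z where z: "z \<in> h ` ?Q" "z \<noteq> x" "dist z x < dist y x"
      using lim[of "dist y x"] y(2) by auto
    have "z \<noteq> y" using z(3) by auto
    then have "min_scale * r \<le> dist y z"
      using y(1) z(1) by (auto intro!: sep)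
    also have "dist y z \<le> dist y x + dist z x"
      by (rule dist_triangle2)
    finally show False
      using y(3) z(3) by linarith
  qed
  ultimately have "finite (h ` ?Q)"
    using bounded_infinite_imp_islimpt by blast
  then show ?thesis
    using inj by (rule finite_imageD)
qed

section \<open>Stages of a tiling along an infinite path\<close>

text \<open>The vertex reached after \<open>k\<close> reversed edges is written as the head of the
  next edge, which also covers \<open>k = 0\<close>.\<close>

definition path_pieces :: "(nat \<Rightarrow> nat) \<Rightarrow> nat \<Rightarrow> ((real^'m \<Rightarrow> real^'m) \<times> 'v) set" where
  "path_pieces \<theta> k = pieces (map \<theta> [0..<k]) (head G (\<theta> k))"

lemma rev_path_arcs:
  assumes "\<theta> \<in> inf_paths (reverse_digraph G)"
  shows "\<theta> k \<in> arcs G" "set (map \<theta> [i..<j]) \<subseteq> arcs G" "tail G (\<theta> k) = head G (\<theta> (Suc k))"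
  using assms by (auto simp: inf_paths_def)

text \<open>Prepending \<open>\<theta> k\<close> to the walk adds the same weight on both sides of
  the inequalities and is cancelled by the new inverse map.\<close>

lemma path_pieces_Suc_subset:
  assumes "\<theta> \<in> inf_paths (reverse_digraph G)"
  shows "path_pieces \<theta> k \<subseteq> path_pieces \<theta> (Suc k)"
proof
  fix q assume "q \<in> path_pieces \<theta> k"
  then obtain p w where p: "q = (inv_comp_maps f (map \<theta> [0..<k]) \<circ> comp_maps f p, w)"
    "awalk (head G (\<theta> k)) p w" "weight (butlast p) \<le> weight (map \<theta> [0..<k])"
    "weight (map \<theta> [0..<k]) < weight p"
    unfolding path_pieces_def by (rule piecesE)
  have "p \<noteq> []" using p(4) by auto
  have "(inv_comp_maps f (map \<theta> [0..<Suc k]) \<circ> comp_maps f (\<theta> k # p), w) \<in> path_pieces \<theta> (Suc k)"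
    unfolding path_pieces_def
    using p(2-4) \<open>p \<noteq> []\<close> rev_path_arcs[OF assms, of k] by (intro piecesI) (auto simp: awalk_Cons_iff)
  moreover have "inv_comp_maps f (map \<theta> [0..<Suc k]) \<circ> comp_maps f (\<theta> k # p)
      = inv_comp_maps f (map \<theta> [0..<k]) \<circ> comp_maps f p"
    using inv_comp_maps_snoc[OF rev_path_arcs(1)[OF assms]] by (auto simp: fun_eq_iff)
  ultimately show "q \<in> path_pieces \<theta> (Suc k)"
    by (simp add: p(1))
qed

lemma path_pieces_mono:
  assumes "\<theta> \<in> inf_paths (reverse_digraph G)" "j \<le> k"
  shows "path_pieces \<theta> j \<subseteq> path_pieces \<theta> k"
  using path_pieces_Suc_subset[OF assms(1)] assms(2) by (rule lift_Suc_mono_le)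

lemma fin_tiling_truncate:
  assumes "\<theta> \<in> inf_paths (reverse_digraph G)"
  shows "fin_tiling G f a (truncate (reverse_digraph G) \<theta> k) = piece_tile ` path_pieces \<theta> k"
proof -
  have "terminal (reverse_digraph G) (head G (\<theta> 0), map \<theta> [0..<k]) = head G (\<theta> k)"
    using inf_paths_cas[OF assms, of 0 k] by (intro terminal_eqI) simp
  then show ?thesis
    by (simp add: truncate_def inf_initial_def fin_tiling_eq path_pieces_def)
qed

lemma inf_tiling_eq:
  assumes "\<theta> \<in> inf_paths (reverse_digraph G)"
  shows "inf_tiling G f a \<theta> = piece_tile ` (\<Union>k. path_pieces \<theta> k)"
proof -
  \<comment> \<open>Stage 0 is contained in stage 1, so a union that starts at 1 misses
    nothing.\<close>
  have "(\<Union>k. path_pieces \<theta> k) = (\<Union>k\<in>{1..}. path_pieces \<theta> k)"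
    using path_pieces_Suc_subset[OF assms] by fastforce
  then show ?thesis
    by (simp add: inf_tiling_def fin_tiling_truncate[OF assms] image_UN)
qed

text \<open>Collects what the later arguments use about tiles, uniformly for finite and infinite
  paths.\<close>

lemma tiling_pieces:
  assumes "T \<in> tilings G f a"
  obtains Q where "T = piece_tile ` Q" "Q \<noteq> {}" "\<And>q. q \<in> Q \<Longrightarrow> snd q \<in> verts G"
    "\<And>q. q \<in> Q \<Longrightarrow> \<exists>c. min_scale \<le> c \<and> c \<le> 1 \<and> (\<forall>x y. dist (fst q x) (fst q y) = c * dist x y)"
    "\<And>R. finite {q \<in> Q. piece_tile q \<inter> cball 0 R \<noteq> {}}"
proof -
  from assms consider (fin) u es where "(u, es) \<in> fin_paths (reverse_digraph G)"
      "T = fin_tiling G f a (u, es)"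
    | (inf) \<theta> where "\<theta> \<in> inf_paths (reverse_digraph G)" "T = inf_tiling G f a \<theta>"
    unfolding tilings_def by (metis Un_iff imageE surj_pair)
  then show ?thesis
  proof cases
    case fin
    let ?R = "reverse_digraph G"
    interpret R: wf_digraph ?R
      by standard (simp_all add: wellformed)
    obtain w where w: "R.awalk u es w"
      using fin(1) by (auto simp: fin_paths_def)
    have es: "set es \<subseteq> arcs G" and "w \<in> verts G" and "terminal ?R (u, es) = w"
      using w R.awalk_last_in_verts[OF w] by (auto simp: R.awalk_def terminal_eqI)
    show ?thesis
    proof (rule that)
      show "T = piece_tile ` pieces es w"
        unfolding fin(2) fin_tiling_eq \<open>terminal ?R (u, es) = w\<close> ..
      show "pieces es w \<noteq> {}"
        by (rule pieces_ne) fact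
      show "finite {q \<in> pieces es w. piece_tile q \<inter> cball 0 R \<noteq> {}}" for R
        by (rule finite_subset[OF _ finite_pieces]) blast
    next
      fix q assume q: "q \<in> pieces es w"
      show "snd q \<in> verts G"
        using q by (rule pieces_end_in_verts)
      show "\<exists>c. min_scale \<le> c \<and> c \<le> 1 \<and> (\<forall>x y. dist (fst q x) (fst q y) = c * dist x y)"
        using q es by (rule pieces_similitude)
    qed
  next
    case inf
    let ?Q = "\<Union>k. path_pieces \<theta> k"
    note th = inf(1)
    from osc obtain U :: "'v \<Rightarrow> (real^'m) set" where
      "\<forall>v\<in>verts G. U v \<noteq> {} \<and> bounded (U v) \<and> open (U v)"
      "\<forall>e\<in>arcs G. f e ` U (head G e) \<subseteq> U (tail G e)"
      "\<forall>e\<in>arcs G. \<forall>d\<in>arcs G. d \<noteq> e \<and> tail G d = tail G e \<longrightarrow>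
        f e ` U (head G e) \<inter> f d ` U (head G d) = {}"
      unfolding open_set_condition_def by (elim exE conjE)
    then have U: "\<And>v. v \<in> verts G \<Longrightarrow> U v \<noteq> {}"
      "\<And>v. v \<in> verts G \<Longrightarrow> open (U v)"
      "\<And>e. e \<in> arcs G \<Longrightarrow> f e ` U (head G e) \<subseteq> U (tail G e)"
      "\<And>e d. \<lbrakk>e \<in> arcs G; d \<in> arcs G; d \<noteq> e; tail G d = tail G e\<rbrakk>
        \<Longrightarrow> f e ` U (head G e) \<inter> f d ` U (head G d) = {}"
      by simp_all
    have verts: "snd q \<in> verts G"
      and sim: "\<exists>c. min_scale \<le> c \<and> c \<le> 1 \<and> (\<forall>x y. dist (fst q x) (fst q y) = c * dist x y)"
      if "q \<in> ?Q" for q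
      using that pieces_end_in_verts pieces_similitude[OF _ rev_path_arcs(2)[OF th]]
      unfolding path_pieces_def by blast+
    have disj: "fst q ` U (snd q) \<inter> fst q' ` U (snd q') = {}"
      if q: "q \<in> ?Q" "q' \<in> ?Q" "q \<noteq> q'" for q q'
    proof -
      \<comment> \<open>Stages increase, so both pieces occur in the common stage
        \<open>max j k\<close>, where disjointness is known.\<close>
      obtain j k where "q \<in> path_pieces \<theta> j" "q' \<in> path_pieces \<theta> k"
        using q by blast
      then have "q \<in> path_pieces \<theta> (max j k)" "q' \<in> path_pieces \<theta> (max j k)"
        using path_pieces_mono[OF th, of j "max j k"] path_pieces_mono[OF th, of k "max j k"] by auto
      then show ?thesis
        unfolding path_pieces_def
        using pieces_disjoint[of U, OF U(3,4) _ _ q(3) rev_path_arcs(2)[OF th]] by blast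
    qed
    have "head G (\<theta> 0) \<in> verts G"
      using rev_path_arcs(1)[OF th] by simp
    then have "?Q \<noteq> {}"
      using pieces_ne unfolding path_pieces_def by fastforce
    moreover have "finite {q \<in> ?Q. piece_tile q \<inter> cball 0 R \<noteq> {}}" for R
      using U(1,2) verts sim disj by (rule finite_pieces_meeting_cball)
    ultimately show ?thesis
      using inf(2) unfolding inf_tiling_eq[OF th] by (intro that[OF _ _ verts sim])
  qed
qed

lemma dist_piece_tile_le:
  assumes "c \<le> 1" "\<And>x y. dist (fst q x) (fst q y) = c * dist x y"
    and "x \<in> piece_tile q" "y \<in> piece_tile q"
  shows "dist x y \<le> 2 * orbit_bound"
proof -
  obtain x' y' where x': "x' \<in> attractor G f (snd q)" "x = fst q x'"
    and y': "y' \<in> attractor G f (snd q)" "y = fst q y'"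
    using assms(3,4) by (auto simp: piece_tile_def)
  have "dist x y \<le> 1 * dist x' y'"
    unfolding x' y' assms(2) using assms(1) by (intro mult_right_mono) auto
  also have "\<dots> \<le> norm x' + norm y'"
    by (simp add: dist_norm norm_triangle_ineq4)
  also have "\<dots> \<le> 2 * orbit_bound"
    using norm_attractor_le[OF x'(1)] norm_attractor_le[OF y'(1)] by simp
  finally show ?thesis .
qed

lemma tile_properties:
  assumes T: "T \<in> tilings G f a" and t: "t \<in> T"
  shows "compact t" "t \<noteq> {}"
proof -
  obtain Q where Q: "T = piece_tile ` Q" "\<And>q. q \<in> Q \<Longrightarrow> snd q \<in> verts G"
    "\<And>q. q \<in> Q \<Longrightarrow> \<exists>c. min_scale \<le> c \<and> c \<le> 1 \<and> (\<forall>x y. dist (fst q x) (fst q y) = c * dist x y)"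
    by (rule tiling_pieces[OF T]) (rule that; assumption)
  obtain q where q: "q \<in> Q" "t = piece_tile q"
    using t Q(1) by blast
  obtain c where c: "min_scale \<le> c" "\<And>x y. dist (fst q x) (fst q y) = c * dist x y"
    using Q(3)[OF q(1)] by blast
  have "c-lipschitz_on UNIV (fst q)"
    using c min_scale_pos by (intro lipschitz_onI) auto
  then have "continuous_on UNIV (fst q)"
    by (rule lipschitz_on_continuous_on)
  then show "compact t"
    unfolding q(2) piece_tile_def
    using compact_attractor by (meson compact_continuous_image continuous_on_subset top_greatest)
  show "t \<noteq> {}"
    unfolding q(2) piece_tile_def using attractor_ne[OF Q(2)[OF q(1)]] by simp
qed

lemma tiling_ne: "T \<in> tilings G f a \<Longrightarrow> T \<noteq> {}"
  by (erule tiling_pieces) simp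

lemma tiling_locally_finite:
  assumes "T \<in> tilings G f a"
  shows "finite {t \<in> T. t \<inter> cball 0 R \<noteq> {}}"
proof -
  obtain Q where Q: "T = piece_tile ` Q" "\<And>R. finite {q \<in> Q. piece_tile q \<inter> cball 0 R \<noteq> {}}"
    by (rule tiling_pieces[OF assms]) (rule that; assumption)
  have "{t \<in> T. t \<inter> cball 0 R \<noteq> {}} = piece_tile ` {q \<in> Q. piece_tile q \<inter> cball 0 R \<noteq> {}}"
    unfolding Q(1) by blast
  then show ?thesis
    using Q(2)[of R] by simp
qed


subsection \<open>The metric on tilings\<close>

lemma stereo_tile:
  "\<lbrakk>T \<in> tilings G f a; t \<in> T\<rbrakk> \<Longrightarrow> stereo ` t \<in> sphere_hyperspace"
  by (intro stereo_compact tile_properties)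

text \<open>Tiles that do not meet a large ball are close to the pole, so local finiteness leaves no other
  limit point in the hyperspace.\<close>

lemma tile_limit_in_tiling:
  assumes T: "T \<in> tilings G f a" and t: "compact t" "t \<noteq> {}"
    and near: "\<And>e. e > 0 \<Longrightarrow> \<exists>t'\<in>T. sphere_hyperspace_dist (stereo ` t) (stereo ` t') < e"
  shows "t \<in> T"
proof (rule ccontr)
  assume "t \<notin> T"
  interpret S: Metric_space "sphere_hyperspace :: ((real^'m) \<times> real) set set" sphere_hyperspace_dist
    by (rule Metric_space_sphere_hyperspace_dist)
  have st: "stereo ` t \<in> sphere_hyperspace" using t by (rule stereo_compact)
  obtain x where x: "x \<in> t" using t(2) by blast
  obtain e R where e: "e > 0" and R: "\<And>y. round_dist (stereo x) (stereo y) < e \<Longrightarrow> norm y \<le> R"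
    using round_dist_stereo_near[of x] by blast
  let ?F = "{t' \<in> T. t' \<inter> cball 0 R \<noteq> {}}"
  have "\<exists>d>0. \<forall>t'\<in>?F. d \<le> sphere_hyperspace_dist (stereo ` t) (stereo ` t')"
  proof (rule finite_uniform_pos)
    show "finite ?F" using T by (rule tiling_locally_finite)
    fix t' assume "t' \<in> ?F"
    then have "t' \<in> T" by simp
    then have "stereo ` t' \<noteq> stereo ` t"
      using \<open>t \<notin> T\<close> by (metis inj_image_eq_iff inj_stereo)
    then have "sphere_hyperspace_dist (stereo ` t) (stereo ` t') > 0"
      using st stereo_tile[OF T \<open>t' \<in> T\<close>] by (intro S.mdist_pos_less) auto
    then show "\<exists>d>0. d \<le> sphere_hyperspace_dist (stereo ` t) (stereo ` t')"
      by blast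
  qed simp
  then obtain d where d: "d > 0" "\<And>t'. t' \<in> ?F \<Longrightarrow> d \<le> sphere_hyperspace_dist (stereo ` t) (stereo ` t')"
    by blast
  \<comment> \<open>Below \<open>e\<close>, the tile must have a point in \<open>cball 0 R\<close>
    and so belong to \<open>?F\<close>; below \<open>d\<close>, it cannot.\<close>
  obtain t' where t': "t' \<in> T" "sphere_hyperspace_dist (stereo ` t) (stereo ` t') < min d e"
    using near[of "min d e"] d(1) e by auto
  have ne: "stereo ` t \<noteq> {}" "stereo ` t' \<noteq> {}"
    using t(2) tile_properties(2)[OF T t'(1)] by simp_all
  have "hausdorff_dist round_dist (stereo ` t) (stereo ` t') < e"
    using t'(2) by (simp add: sphere_hyperspace_dist_def)
  from hausdorff_dist_lessD(1)[OF round_dist_le_pi ne this, of "stereo x"] x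
  obtain x' where x': "x' \<in> t'" "round_dist (stereo x) (stereo x') < e"
    by blast
  then have "t' \<in> ?F"
    using t'(1) R[OF x'(2)] by auto
  with d(2) t'(2) show False by fastforce
qed

section \<open>Tiling distance in terms of tiles\<close>

lemma in_stereo_closure:
  assumes "T \<in> tilings G f a"
  shows "K \<in> stereo_closure T \<longleftrightarrow> K \<in> sphere_hyperspace \<and>
    (\<forall>e>0. \<exists>t\<in>T. sphere_hyperspace_dist K (stereo ` t) < e)"
proof -
  interpret S: Metric_space "sphere_hyperspace :: ((real^'m) \<times> real) set set" sphere_hyperspace_dist
    by (rule Metric_space_sphere_hyperspace_dist)
  show ?thesis
    unfolding stereo_closure_def S.metric_closure_of
    using stereo_tile[OF assms] by auto
qed

lemma stereo_in_closure:
  assumes "T \<in> tilings G f a" "t \<in> T"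
  shows "stereo ` t \<in> stereo_closure T"
proof -
  interpret S: Metric_space "sphere_hyperspace :: ((real^'m) \<times> real) set set" sphere_hyperspace_dist
    by (rule Metric_space_sphere_hyperspace_dist)
  have "sphere_hyperspace_dist (stereo ` t) (stereo ` t) = 0"
    using stereo_tile[OF assms] by (rule S.mdist_zero)
  then show ?thesis
    unfolding in_stereo_closure[OF assms(1)] using stereo_tile[OF assms] assms(2) by metis
qed

text \<open>The Hausdorff distance first yields a member of the closure; the slack in the strict
  inequality pays for replacing it by a projected tile.\<close>

lemma tiling_dist_lessD:
  assumes T: "T1 \<in> tilings G f a" "T2 \<in> tilings G f a"
    and less: "tiling_dist T1 T2 < e" and t: "t \<in> T1"
  shows "\<exists>t'\<in>T2. sphere_hyperspace_dist (stereo ` t) (stereo ` t') < e"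
proof -
  interpret S: Metric_space "sphere_hyperspace :: ((real^'m) \<times> real) set set" sphere_hyperspace_dist
    by (rule Metric_space_sphere_hyperspace_dist)
  have sub: "stereo_closure T1 \<subseteq> sphere_hyperspace" "stereo_closure T2 \<subseteq> sphere_hyperspace"
    using in_stereo_closure T by blast+
  obtain t2 where "t2 \<in> T2" using tiling_ne[OF T(2)] by blast
  then have ne: "stereo_closure T1 \<noteq> {}" "stereo_closure T2 \<noteq> {}"
    using stereo_in_closure T t by blast+
  have "\<exists>K\<in>stereo_closure T2. sphere_hyperspace_dist (stereo ` t) K < e"
    using less sub ne stereo_in_closure[OF T(1) t] unfolding tiling_dist_def
    by (intro hausdorff_dist_lessD(1)[where C = pi]) (auto intro: sphere_hyperspace_dist_le_pi)
  then obtain K where K: "K \<in> stereo_closure T2" "sphere_hyperspace_dist (stereo ` t) K < e"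
    by blast
  then obtain t' where t': "t' \<in> T2"
    "sphere_hyperspace_dist K (stereo ` t') < e - sphere_hyperspace_dist (stereo ` t) K"
    using iffD1[OF in_stereo_closure[OF T(2)] K(1)] diff_gt_0_iff_gt by blast
  have "sphere_hyperspace_dist (stereo ` t) (stereo ` t')
      \<le> sphere_hyperspace_dist (stereo ` t) K + sphere_hyperspace_dist K (stereo ` t')"
    using K(1) sub(2) stereo_tile[OF T(1) t] stereo_tile[OF T(2) t'(1)] by (intro S.triangle) auto
  with t' show ?thesis by force
qed

text \<open>A member of one closure is within \<open>e\<close> of a projected tile, which is within
  \<open>e\<close> of one of the other tiling; hence the factor 2.\<close>

lemma tiling_dist_le:
  assumes T: "T1 \<in> tilings G f a" "T2 \<in> tilings G f a" and e: "e > 0"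
    and 1: "\<And>t. t \<in> T1 \<Longrightarrow> \<exists>t'\<in>T2. sphere_hyperspace_dist (stereo ` t) (stereo ` t') < e"
    and 2: "\<And>t. t \<in> T2 \<Longrightarrow> \<exists>t'\<in>T1. sphere_hyperspace_dist (stereo ` t) (stereo ` t') < e"
  shows "tiling_dist T1 T2 \<le> 2 * e"
proof -
  interpret S: Metric_space "sphere_hyperspace :: ((real^'m) \<times> real) set set" sphere_hyperspace_dist
    by (rule Metric_space_sphere_hyperspace_dist)
  have *: "\<exists>L\<in>stereo_closure T'. sphere_hyperspace_dist K L \<le> 2 * e"
    if T: "T \<in> tilings G f a" "T' \<in> tilings G f a" and K: "K \<in> stereo_closure T"
      and near: "\<And>t. t \<in> T \<Longrightarrow> \<exists>t'\<in>T'. sphere_hyperspace_dist (stereo ` t) (stereo ` t') < e"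
    for T T' K
  proof -
    have KS: "K \<in> sphere_hyperspace" using in_stereo_closure T K by blast
    obtain t where t: "t \<in> T" "sphere_hyperspace_dist K (stereo ` t) < e"
      using K e unfolding in_stereo_closure[OF T(1)] by blast
    obtain t' where t': "t' \<in> T'" "sphere_hyperspace_dist (stereo ` t) (stereo ` t') < e"
      using near[OF t(1)] by blast
    have "sphere_hyperspace_dist K (stereo ` t')
      \<le> sphere_hyperspace_dist K (stereo ` t) + sphere_hyperspace_dist (stereo ` t) (stereo ` t')"
      using KS stereo_tile[OF T(1) t(1)] stereo_tile[OF T(2) t'(1)] by (rule S.triangle)
    also have "\<dots> \<le> 2 * e"
      using t(2) t'(2) by linarith
    finally show ?thesis
      using stereo_in_closure[OF T(2) t'(1)] by blast
  qed
  show ?thesis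
    unfolding tiling_dist_def
  proof (rule hausdorff_dist_le)
    show "\<exists>L\<in>stereo_closure T2. sphere_hyperspace_dist K L \<le> 2 * e" if "K \<in> stereo_closure T1" for K
      using *[OF T that 1] .
    show "\<exists>K\<in>stereo_closure T1. sphere_hyperspace_dist K L \<le> 2 * e" if "L \<in> stereo_closure T2" for L
      using *[OF T(2,1) that 2] by (simp add: S.commute)
  qed (use e in simp)
qed

text \<open>The closures form a metric space under the Hausdorff distance, and a tiling can be
  recovered from its closure.\<close>

lemma Metric_space_tiling_dist: "Metric_space (tilings G f a) tiling_dist"
proof -
  interpret S: Metric_space "sphere_hyperspace :: ((real^'m) \<times> real) set set" sphere_hyperspace_dist
    by (rule Metric_space_sphere_hyperspace_dist)
  have H: "Metric_space (stereo_closure ` tilings G f a) (hausdorff_dist sphere_hyperspace_dist)"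
  proof (rule Metric_space_hausdorff_dist[OF S.Metric_space_axioms sphere_hyperspace_dist_le_pi])
    fix K :: "((real^'m) \<times> real) set set" and x
    assume "K \<in> stereo_closure ` tilings G f a"
    then obtain T where T: "T \<in> tilings G f a" "K = stereo_closure T" by blast
    obtain t where "t \<in> T" using tiling_ne[OF T(1)] by blast
    then show "K \<subseteq> sphere_hyperspace \<and> K \<noteq> {}"
      using in_stereo_closure[OF T(1)] stereo_in_closure[OF T(1)] T(2) by blast
    assume x: "x \<in> sphere_hyperspace" and near: "\<And>e. e > 0 \<Longrightarrow> \<exists>L\<in>K. sphere_hyperspace_dist x L < e"
    \<comment> \<open>A limit of members of the closure is again a limit of projected tiles.\<close>
    have "\<exists>t\<in>T. sphere_hyperspace_dist x (stereo ` t) < e" if e: "e > 0" for e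
    proof -
      obtain L where L: "L \<in> K" "sphere_hyperspace_dist x L < e / 2"
        using near[OF half_gt_zero[OF e]] by blast
      then have LS: "L \<in> sphere_hyperspace" and "\<exists>t\<in>T. sphere_hyperspace_dist L (stereo ` t) < e / 2"
        using half_gt_zero[OF e] unfolding T(2) in_stereo_closure[OF T(1)] by blast+
      then obtain t where t: "t \<in> T" "sphere_hyperspace_dist L (stereo ` t) < e / 2"
        by blast
      have "sphere_hyperspace_dist x (stereo ` t)
        \<le> sphere_hyperspace_dist x L + sphere_hyperspace_dist L (stereo ` t)"
        using x LS stereo_tile[OF T(1) t(1)] by (rule S.triangle)
      then show ?thesis
        using t L(2) by force
    qed
    then show "x \<in> K"
      unfolding T(2) in_stereo_closure[OF T(1)] using x by blast
  qed
  interpret H: Metric_space "stereo_closure ` tilings G f a" "hausdorff_dist sphere_hyperspace_dist"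
    by (rule H)
  \<comment> \<open>A tile of \<open>T1\<close> is a limit of tiles of \<open>T2\<close>, and local
    finiteness makes it one of them.\<close>
  have sub: "T1 \<subseteq> T2"
    if T: "T1 \<in> tilings G f a" "T2 \<in> tilings G f a" and eq: "stereo_closure T1 = stereo_closure T2"
    for T1 T2
  proof
    fix t assume t: "t \<in> T1"
    show "t \<in> T2"
    proof (rule tile_limit_in_tiling[OF T(2) tile_properties[OF T(1) t]])
      fix e :: real assume "e > 0"
      then show "\<exists>t'\<in>T2. sphere_hyperspace_dist (stereo ` t) (stereo ` t') < e"
        using stereo_in_closure[OF T(1) t] unfolding eq in_stereo_closure[OF T(2)] by blast
    qed
  qed
  show ?thesis
  proof
    fix T1 T2 T3 :: "(real^'m) set set"
    show "0 \<le> tiling_dist T1 T2" "tiling_dist T1 T2 = tiling_dist T2 T1"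
      unfolding tiling_dist_def by (rule H.nonneg H.commute)+
    assume T: "T1 \<in> tilings G f a" "T2 \<in> tilings G f a"
    show "tiling_dist T1 T2 = 0 \<longleftrightarrow> T1 = T2"
      unfolding tiling_dist_def using T sub[OF T] sub[OF T(2,1)] by auto
    assume "T3 \<in> tilings G f a"
    with T show "tiling_dist T1 T3 \<le> tiling_dist T1 T2 + tiling_dist T2 T3"
      unfolding tiling_dist_def by (intro H.triangle) auto
  qed
qed


subsection \<open>Continuity at reversible points\<close>

lemma inf_tiling_in_tilings: "\<theta> \<in> inf_paths (reverse_digraph G) \<Longrightarrow> inf_tiling G f a \<theta> \<in> tilings G f a"
  by (simp add: tilings_def)

text \<open>The vertex at stage \<open>n\<close> is the tail of the edge with index
  \<open>n - 1\<close>; an empty prefix would not determine it.\<close>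

lemma path_pieces_cong:
  assumes "\<theta> \<in> inf_paths (reverse_digraph G)" "\<psi> \<in> inf_paths (reverse_digraph G)"
    and "\<And>i. i < n \<Longrightarrow> \<psi> i = \<theta> i" and "n \<ge> 1"
  shows "map \<psi> [0..<n] = map \<theta> [0..<n]" "head G (\<psi> n) = head G (\<theta> n)"
    "path_pieces \<psi> n = path_pieces \<theta> n"
proof -
  show 1: "map \<psi> [0..<n] = map \<theta> [0..<n]" using assms(3) by simp
  obtain m where m: "n = Suc m" using assms(4) by (cases n) auto
  show 2: "head G (\<psi> n) = head G (\<theta> n)"
    using rev_path_arcs(3)[OF assms(1), of m] rev_path_arcs(3)[OF assms(2), of m] assms(3)[of m]
    by (simp add: m)
  show "path_pieces \<psi> n = path_pieces \<theta> n"
    by (simp add: path_pieces_def 1 2)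
qed

lemma inf_tiling_prefix_subset:
  assumes "\<theta> \<in> inf_paths (reverse_digraph G)" "\<psi> \<in> inf_paths (reverse_digraph G)"
    and "\<And>i. i < n \<Longrightarrow> \<psi> i = \<theta> i" and "n \<ge> 1" and "k \<le> n"
  shows "piece_tile ` path_pieces \<theta> k \<subseteq> inf_tiling G f a \<psi>"
proof -
  have "path_pieces \<theta> k \<subseteq> path_pieces \<psi> n"
    using path_pieces_mono[OF assms(1,5)] path_pieces_cong(3)[OF assms(1,2,3,4)] by simp
  then show ?thesis
    unfolding inf_tiling_eq[OF assms(2)] by blast
qed

lemma rev_path_awalk:
  assumes "\<psi> \<in> inf_paths (reverse_digraph G)"
  shows "(head G (\<psi> i), map \<psi> [i..<i + k]) \<in> fin_paths (reverse_digraph G)"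
    "terminal (reverse_digraph G) (head G (\<psi> i), map \<psi> [i..<i + k]) = head G (\<psi> (i + k))"
proof -
  have cas: "pre_digraph.cas (reverse_digraph G) (head G (\<psi> i)) (map \<psi> [i..<i + k]) (head G (\<psi> (i + k)))"
    using inf_paths_cas[OF assms, of i k] by simp
  then show "terminal (reverse_digraph G) (head G (\<psi> i), map \<psi> [i..<i + k]) = head G (\<psi> (i + k))"
    by (rule terminal_eqI)
  show "(head G (\<psi> i), map \<psi> [i..<i + k]) \<in> fin_paths (reverse_digraph G)"
    using cas rev_path_arcs(1,2)[OF assms] unfolding fin_paths_def pre_digraph.awalk_def by fastforce
qed

text \<open>A tile of a later stage that is not already a tile of stage \<open>n\<close> leaves the reversed path at
  some edge after \<open>n\<close>.\<close>

lemma path_pieces_branch: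
  assumes \<psi>: "\<psi> \<in> inf_paths (reverse_digraph G)" and "n \<le> j" and "q \<in> path_pieces \<psi> j"
  shows "q \<in> path_pieces \<psi> n \<or>
    piece_tile q \<subseteq> inv_comp_maps f (map \<psi> [0..<n]) ` H_set G f (head G (\<psi> n))"
  using assms(2,3)
proof (induction j arbitrary: q rule: dec_induct)
  case (step j)
  obtain p w where q: "q = (inv_comp_maps f (map \<psi> [0..<Suc j]) \<circ> comp_maps f p, w)"
    and p: "awalk (head G (\<psi> (Suc j))) p w"
      "weight (butlast p) \<le> weight (map \<psi> [0..<Suc j])" "weight (map \<psi> [0..<Suc j]) < weight p"
    using step.prems unfolding path_pieces_def by (rule piecesE)
  obtain e p' where p': "p = e # p'" using p(3) by (cases p) auto
  note arcs = rev_path_arcs(1)[OF \<psi>]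
  show ?case
  proof (cases "e = \<psi> j")
    \<comment> \<open>The first edge of the walk undoes the last reversed edge, so the piece already
      occurs at stage \<open>j\<close>.\<close>
    case True
    have "weight (map \<psi> [0..<j]) < weight p'"
      using p(3) by (simp add: p' True)
    moreover from this have "p' \<noteq> []" by auto
    ultimately have "(inv_comp_maps f (map \<psi> [0..<j]) \<circ> comp_maps f p', w) \<in> path_pieces \<psi> j"
      using p unfolding path_pieces_def p' True by (intro piecesI) (auto simp: awalk_Cons_iff)
    moreover have "inv_comp_maps f (map \<psi> [0..<Suc j]) \<circ> comp_maps f p
        = inv_comp_maps f (map \<psi> [0..<j]) \<circ> comp_maps f p'"
      using inv_comp_maps_snoc[OF arcs] by (auto simp: fun_eq_iff p' True)
    ultimately have "q \<in> path_pieces \<psi> j"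
      by (simp add: q)
    then show ?thesis by (rule step.IH)
  next
    case False
    \<comment> \<open>The reversed edges with indices \<open>n\<close> to \<open>j\<close> and the
      walk \<open>p\<close> form a pair as in \<open>H_set\<close>, since \<open>\<psi> j\<close>
      differs from the first edge of \<open>p\<close>.\<close>
    let ?k = "Suc j - n"
    let ?\<theta> = "(head G (\<psi> n), map \<psi> [n..<n + ?k])" and ?\<sigma> = "(head G (\<psi> (Suc j)), p)"
    have nk: "n + ?k = Suc j" using step.hyps by simp
    have "last (map \<psi> [n..<n + ?k]) = \<psi> j" "map \<psi> [n..<n + ?k] \<noteq> []"
      using step.hyps unfolding nk by (simp_all add: last_map)
    moreover have "?\<sigma> \<in> fin_paths G"
      using p(1) by (auto simp: fin_paths_def)
    ultimately have "inv_comp_maps f (edges ?\<theta>) ` tile G f ?\<sigma> \<subseteq> H_set G f (head G (\<psi> n))"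
      unfolding H_set_def using rev_path_awalk[OF \<psi>, of n ?k] False
      by (intro Sup_upper CollectI exI[of _ ?\<theta>] exI[of _ ?\<sigma>]) (simp add: nk edges_def initial_def p')
    moreover have "piece_tile q
        = inv_comp_maps f (map \<psi> [0..<n]) ` (inv_comp_maps f (edges ?\<theta>) ` tile G f ?\<sigma>)"
    proof -
      have "[0..<Suc j] = [0..<n] @ [n..<n + ?k]"
        unfolding nk using step.hyps by (metis le0 le_SucI le_Suc_ex upt_add_eq_append)
      then have "inv_comp_maps f (map \<psi> [0..<Suc j])
          = inv_comp_maps f (map \<psi> [0..<n]) \<circ> inv_comp_maps f (map \<psi> [n..<n + ?k])"
        by (metis inv_comp_maps_append map_append)
      then show ?thesis
        by (simp add: q piece_tile_def tile_def edges_def awalk_terminal[OF p(1)] image_comp comp_assoc)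
    qed
    ultimately show ?thesis by blast
  qed
qed simp

section \<open>Tiles far from the origin\<close>

lemma power_s_unbounded:
  assumes "0 < d"
  shows "\<exists>k\<ge>1. C < d / s ^ k"
proof -
  have "(\<lambda>k. s ^ k * \<bar>C\<bar>) \<longlonglongrightarrow> 0"
    using s_pos s_less_1 by (intro tendsto_mult_left_zero LIMSEQ_power_zero) simp
  then have "\<forall>\<^sub>F k in sequentially. s ^ k * \<bar>C\<bar> < d"
    using assms by (intro order_tendstoD) auto
  then obtain N where N: "\<And>k. k \<ge> N \<Longrightarrow> s ^ k * \<bar>C\<bar> < d"
    by (auto simp: eventually_sequentially)
  have "\<bar>C\<bar> < d / s ^ Suc N"
    using N[of "Suc N"] s_pos by (simp add: pos_less_divide_eq mult.commute)
  then show ?thesis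
    by (intro exI[of _ "Suc N"]) auto
qed

text \<open>Nearby paths will share this tile, so that it can be matched with any tile outside the
  ball. Expansion moves two points of an attractor so far apart that one of them leaves the ball by
  more than the diameter of a tile.\<close>

lemma far_piece:
  assumes \<theta>: "\<theta> \<in> inf_paths (reverse_digraph G)"
  shows "\<exists>k. \<exists>q\<in>path_pieces \<theta> k. piece_tile q \<inter> ball 0 R = {}"
proof -
  obtain \<eta> where \<eta>: "\<eta> > 0"
    "\<And>v. v \<in> verts G \<Longrightarrow> \<exists>x\<in>attractor G f v. \<exists>y\<in>attractor G f v. \<eta> \<le> dist x y"
    using attractor_spread by blast
  \<comment> \<open>The inner \<open>2 * orbit_bound\<close> bounds the diameter of a tile; the
    outer factor 2 is there because a sum of two norms is bounded below and only one of them need be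
    large.\<close>
  obtain k where k: "2 * (R + 2 * orbit_bound) < \<eta> / s ^ k"
    using power_s_unbounded[OF \<eta>(1)] by blast
  let ?es = "map \<theta> [0..<k]" and ?v = "head G (\<theta> k)"
  let ?g = "inv_comp_maps f ?es"
  have arcs: "set ?es \<subseteq> arcs G" by (rule rev_path_arcs(2)[OF \<theta>])
  have "?v \<in> verts G" using rev_path_arcs(1)[OF \<theta>] by simp
  then obtain x y where xy: "x \<in> attractor G f ?v" "y \<in> attractor G f ?v" "\<eta> \<le> dist x y"
    using \<eta>(2) by blast
  have "\<eta> / s ^ k \<le> dist x y / s ^ weight ?es"
    using xy(3) \<eta>(1) s_pos s_less_1 length_le_weight[OF arcs]
    by (intro frac_le power_decreasing) auto
  also have "\<dots> = dist (?g x) (?g y)"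
    by (rule dist_inv_comp_maps[OF arcs, symmetric])
  also have "\<dots> \<le> norm (?g x) + norm (?g y)"
    by (simp add: dist_norm norm_triangle_ineq4)
  finally have "\<eta> / s ^ k \<le> norm (?g x) + norm (?g y)" .
  with k have "2 * (R + 2 * orbit_bound) < norm (?g x) + norm (?g y)"
    by (rule less_le_trans)
  then have "R + 2 * orbit_bound < norm (?g x) \<or> R + 2 * orbit_bound < norm (?g y)"
    by argo
  then obtain z where z: "z \<in> attractor G f ?v" "R + 2 * orbit_bound < norm (?g z)"
    using xy by blast
  obtain p w where p: "awalk ?v p w" "weight (butlast p) \<le> weight ?es" "weight ?es < weight p"
    "z \<in> comp_maps f p ` attractor G f w"
    using attractor_cover[OF z(1)] by blast
  let ?q = "(?g \<circ> comp_maps f p, w)"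
  have q: "?q \<in> path_pieces \<theta> k"
    unfolding path_pieces_def using p(1-3) by (rule piecesI)
  then obtain c where c: "c \<le> 1" "\<And>x y. dist (fst ?q x) (fst ?q y) = c * dist x y"
    using pieces_similitude[OF _ arcs] unfolding path_pieces_def by blast
  have gz: "?g z \<in> piece_tile ?q"
    using p(4) by (auto simp: piece_tile_def)
  have "R \<le> norm y" if "y \<in> piece_tile ?q" for y
  proof -
    have "dist (?g z) y \<le> 2 * orbit_bound"
      using c gz that by (rule dist_piece_tile_le)
    then show ?thesis
      using z(2) norm_triangle_sub[of "?g z" y] by (simp add: dist_norm)
  qed
  then have "piece_tile ?q \<inter> ball 0 R = {}"
    by fastforce
  with q show ?thesis by blast
qed

lemma reversible_local:
  assumes "\<theta> \<in> reversible_paths G f"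
  shows "\<exists>n\<ge>1. \<forall>\<psi>\<in>inf_paths (reverse_digraph G). (\<forall>i<n. \<psi> i = \<theta> i) \<longrightarrow>
    (\<forall>t\<in>inf_tiling G f a \<psi>. t \<in> piece_tile ` path_pieces \<theta> n \<or> t \<inter> ball 0 R = {})"
proof -
  have \<theta>: "\<theta> \<in> inf_paths (reverse_digraph G)"
    using assms by (simp add: reversible_paths_def)
  obtain \<sigma> where \<sigma>: "\<sigma> \<in> inf_paths G"
    and central: "address f \<sigma> \<in> central_open_set G f (inf_initial G \<sigma>)"
    and rev: "\<And>L M. \<exists>m\<ge>M. map \<sigma> [0..<L] = rev (map \<theta> [m..<m + L])"
    using assms unfolding reversible_paths_def by blast
  define H where "H = H_set G f (tail G (\<sigma> 0))"
  define \<delta> where "\<delta> = infdist (address f \<sigma>) H"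
  \<comment> \<open>The central open set is given by a strict inequality with nonnegative left side.
    This also excludes an empty \<open>H\<close>, where \<open>infdist\<close> would be 0.\<close>
  have \<delta>: "0 < \<delta>"
    using central infdist_nonneg[of "address f \<sigma>" "attractor G f (inf_initial G \<sigma>)"]
    by (simp add: central_open_set_def \<delta>_def H_def inf_initial_def)
  \<comment> \<open>Expansion of \<delta> over \<open>L\<close> edges is to outweigh the radius and
    the constant in \<open>norm_Ix\<close>.\<close>
  obtain L where L: "L \<ge> 1" "\<bar>R\<bar> + 2 * orbit_bound < \<delta> / s ^ L"
    using power_s_unbounded[OF \<delta>] by blast
  obtain m where m: "map \<sigma> [0..<L] = rev (map \<theta> [m..<m + L])"
    using rev by blast
  define n where "n = m + L"
  have n: "n \<ge> 1" using L(1) by (simp add: n_def)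
  let ?x = "address f \<sigma>" and ?es = "map \<theta> [0..<m]" and ?ds = "map \<theta> [m..<n]"
  let ?I = "inv_comp_maps f (map \<theta> [0..<n])"
  have es: "set ?es \<subseteq> arcs G" and ds: "set ?ds \<subseteq> arcs G" and nn: "set (map \<theta> [0..<n]) \<subseteq> arcs G"
    by (rule rev_path_arcs(2)[OF \<theta>])+
  have split: "map \<theta> [0..<n] = ?es @ ?ds"
    unfolding n_def by (metis le0 map_append upt_add_eq_append)
  have \<sigma>_arcs: "\<sigma> k \<in> arcs G" for k using \<sigma> by (rule inf_paths_arcs)
  \<comment> \<open>As \<open>L\<close> is positive, \<open>\<sigma> 0\<close> is
    \<open>\<theta> (n - 1)\<close>, so \<open>H\<close> belongs to the vertex reached at stage
    \<open>n\<close>.\<close>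
  have head_n: "head G (\<theta> n) = tail G (\<sigma> 0)"
  proof -
    have "\<sigma> 0 = hd (map \<sigma> [0..<L])"
      using L(1) by (simp add: hd_map)
    also have "\<dots> = last (map \<theta> [m..<m + L])"
      by (simp add: m hd_rev)
    also have "\<dots> = \<theta> (m + L - 1)"
      using L(1) by (simp add: last_map)
    finally show ?thesis
      using rev_path_arcs(3)[OF \<theta>, of "m + L - 1"] L(1) by (simp add: n_def)
  qed
  define z where "z = address f (\<lambda>i. \<sigma> (L + i))"
  \<comment> \<open>The inverse maps along \<open>?ds\<close> cancel the first \<open>L\<close> maps
    of the address, so only the expansion along \<open>?es\<close> remains.\<close>
  have Ix: "?I ?x = inv_comp_maps f ?es z"
  proof -
    have "?x = comp_maps f (rev ?ds) z"
      unfolding z_def n_def m[symmetric] using \<sigma>_arcs by (rule address_prefix)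
    then show ?thesis
      unfolding split inv_comp_maps_append using inv_comp_maps_rev[OF ds] by simp
  qed
  have norm_Ix: "norm (?I ?x) \<le> 2 * orbit_bound / s ^ weight ?es"
  proof -
    \<comment> \<open>The point that the inverse maps along \<open>?es\<close> send to the origin;
      it turns the norm into a distance.\<close>
    let ?o = "comp_maps f (rev ?es) 0"
    have "norm (?I ?x) = dist (inv_comp_maps f ?es z) (inv_comp_maps f ?es ?o)"
      unfolding Ix inv_comp_maps_rev[OF es] by simp
    also have "\<dots> = dist z ?o / s ^ weight ?es"
      by (rule dist_inv_comp_maps[OF es])
    also have "dist z ?o \<le> norm z + norm ?o"
      by (simp add: dist_norm norm_triangle_ineq4)
    also have "\<dots> \<le> 2 * orbit_bound"
      using norm_address_le[of "\<lambda>i. \<sigma> (L + i)"] \<sigma>_arcs norm_comp_maps_0_le[of "rev ?es"] es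
      by (simp add: z_def)
    finally show ?thesis
      using s_pos by (simp add: divide_right_mono)
  qed
  have far: "\<bar>R\<bar> \<le> norm (?I y)" if y: "y \<in> H" for y
  proof -
    have "\<delta> \<le> dist ?x y"
      unfolding \<delta>_def using y by (rule infdist_le)
    have "L \<le> weight ?ds"
      using length_le_weight[OF ds] by (simp add: n_def)
    then have w: "weight ?es + L \<le> weight (map \<theta> [0..<n])"
      unfolding split by simp
    have "\<delta> / s ^ (weight ?es + L) \<le> dist ?x y / s ^ weight (map \<theta> [0..<n])"
      using \<open>\<delta> \<le> dist ?x y\<close> \<delta> s_pos s_less_1 w by (intro frac_le power_decreasing) auto
    also have "\<dots> = dist (?I ?x) (?I y)"
      by (rule dist_inv_comp_maps[OF nn, symmetric])
    also have "\<dots> \<le> norm (?I ?x) + norm (?I y)"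
      by (simp add: dist_norm norm_triangle_ineq4)
    finally have "\<delta> / s ^ (weight ?es + L) - 2 * orbit_bound / s ^ weight ?es \<le> norm (?I y)"
      using norm_Ix by linarith
    also have "\<delta> / s ^ (weight ?es + L) - 2 * orbit_bound / s ^ weight ?es
        = (\<delta> / s ^ L - 2 * orbit_bound) / s ^ weight ?es"
      by (simp add: power_add diff_divide_distrib mult.commute)
    finally have "(\<delta> / s ^ L - 2 * orbit_bound) / s ^ weight ?es \<le> norm (?I y)" .
    \<comment> \<open>The denominator is at most 1, so the division only increases a number that
      exceeds \<open>\<bar>R\<bar>\<close>.\<close>
    moreover have "\<bar>R\<bar> / 1 \<le> (\<delta> / s ^ L - 2 * orbit_bound) / s ^ weight ?es"
      using L(2) s_pos s_less_1 by (intro frac_le power_le_one) auto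
    ultimately show ?thesis by simp
  qed
  show ?thesis
  proof (intro exI conjI ballI impI)
    show "1 \<le> n" by (rule n)
    fix \<psi> t
    assume \<psi>: "\<psi> \<in> inf_paths (reverse_digraph G)" and "\<forall>i<n. \<psi> i = \<theta> i"
      and "t \<in> inf_tiling G f a \<psi>"
    then have eq: "\<And>i. i < n \<Longrightarrow> \<psi> i = \<theta> i" by simp
    obtain j q where q: "q \<in> path_pieces \<psi> j" "t = piece_tile q"
      using \<open>t \<in> inf_tiling G f a \<psi>\<close> unfolding inf_tiling_eq[OF \<psi>] by blast
    have "q \<in> path_pieces \<psi> (max j n)"
      using q(1) path_pieces_mono[OF \<psi>, of j "max j n"] by auto
    then have "q \<in> path_pieces \<psi> n \<or> t \<subseteq> inv_comp_maps f (map \<psi> [0..<n]) ` H_set G f (head G (\<psi> n))"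
      unfolding q(2) by (intro path_pieces_branch[OF \<psi>, of n "max j n"]) auto
    then have "q \<in> path_pieces \<theta> n \<or> t \<subseteq> ?I ` H"
      using path_pieces_cong[of \<theta> \<psi> n, OF \<theta> \<psi> eq n] head_n by (simp add: H_def)
    then show "t \<in> piece_tile ` path_pieces \<theta> n \<or> t \<inter> ball 0 R = {}"
    proof
      assume "t \<subseteq> ?I ` H"
      then have "t \<inter> ball 0 R = {}"
        using far by fastforce
      then show ?thesis ..
    qed (use q(2) in blast)
  qed
qed

lemma reversible_continuous_at:
  assumes rev: "\<theta> \<in> reversible_paths G f" and "e > 0"
  shows "\<exists>n. \<forall>\<psi>\<in>inf_paths (reverse_digraph G). (\<forall>i<n. \<psi> i = \<theta> i) \<longrightarrow>
    tiling_dist (inf_tiling G f a \<theta>) (inf_tiling G f a \<psi>) < e"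
proof -
  interpret S: Metric_space "sphere_hyperspace :: ((real^'m) \<times> real) set set" sphere_hyperspace_dist
    by (rule Metric_space_sphere_hyperspace_dist)
  have \<theta>: "\<theta> \<in> inf_paths (reverse_digraph G)"
    using rev by (simp add: reversible_paths_def)
  \<comment> \<open>Tiles will be matched with error below \<open>r + r / 2\<close>, and passing to
    closures doubles this to 3e/4.\<close>
  define r where "r = e / 4"
  have r: "0 < r" using \<open>e > 0\<close> by (simp add: r_def)
  obtain R where R: "\<And>x y :: real^'m. \<lbrakk>R \<le> norm x; R \<le> norm y\<rbrakk> \<Longrightarrow> round_dist (stereo x) (stereo y) < r"
    using round_dist_stereo_far[OF r] by blast
  have outside: "sphere_hyperspace_dist (stereo ` t) (stereo ` t') \<le> r"
    if t: "t \<inter> ball 0 R = {}" "t' \<inter> ball 0 R = {}" "t \<noteq> {}" "t' \<noteq> {}" for t t' :: "(real^'m) set"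
  proof -
    have *: "R \<le> norm x" if "x \<in> t \<or> x \<in> t'" for x
      using that t(1,2) by (meson disjoint_iff mem_ball_0 not_le)
    obtain x x' where x: "x \<in> t" "x' \<in> t'" using t(3,4) by blast
    have "\<exists>y\<in>stereo ` t'. round_dist (stereo z) y \<le> r" if "z \<in> t" for z
      using R[of z x'] * that x by (intro bexI[of _ "stereo x'"]) auto
    moreover have "\<exists>y\<in>stereo ` t. round_dist y (stereo z) \<le> r" if "z \<in> t'" for z
      using R[of x z] * that x by (intro bexI[of _ "stereo x"]) auto
    ultimately show ?thesis
      unfolding sphere_hyperspace_dist_def using r by (intro hausdorff_dist_le) auto
  qed
  obtain n1 where n1: "n1 \<ge> 1"
    and local: "\<forall>\<psi>\<in>inf_paths (reverse_digraph G). (\<forall>i<n1. \<psi> i = \<theta> i) \<longrightarrow>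
      (\<forall>t\<in>inf_tiling G f a \<psi>. t \<in> piece_tile ` path_pieces \<theta> n1 \<or> t \<inter> ball 0 R = {})"
    using reversible_local[OF rev, of R] by (elim exE conjE)
  obtain k q where q: "q \<in> path_pieces \<theta> k" "piece_tile q \<inter> ball 0 R = {}"
    using far_piece[OF \<theta>] by blast
  \<comment> \<open>The prefix has to fix both the stage containing the tiles that meet the ball and
    the stage of the far tile.\<close>
  define n where "n = max n1 k"
  \<comment> \<open>Stated for any two paths with this prefix, so that it yields both directions of
    the Hausdorff distance.\<close>
  have near: "\<exists>t'\<in>inf_tiling G f a \<phi>. sphere_hyperspace_dist (stereo ` t) (stereo ` t') < r + r / 2"
    if \<psi>: "\<psi> \<in> inf_paths (reverse_digraph G)" "\<And>i. i < n \<Longrightarrow> \<psi> i = \<theta> i"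
      and \<phi>: "\<phi> \<in> inf_paths (reverse_digraph G)" "\<And>i. i < n \<Longrightarrow> \<phi> i = \<theta> i"
      and t: "t \<in> inf_tiling G f a \<psi>" for \<psi> \<phi> t
  proof -
    have sub: "piece_tile ` path_pieces \<theta> n1 \<subseteq> inf_tiling G f a \<phi>"
      "piece_tile ` path_pieces \<theta> k \<subseteq> inf_tiling G f a \<phi>"
      by (rule inf_tiling_prefix_subset[of _ _ n, OF \<theta> \<phi>]; use n1 in \<open>simp add: n_def\<close>)+
    note T = inf_tiling_in_tilings[OF \<psi>(1)] and T' = inf_tiling_in_tilings[OF \<phi>(1)]
    have "\<forall>i<n1. \<psi> i = \<theta> i" using \<psi>(2) by (simp add: n_def)
    with local \<psi>(1) t have "t \<in> piece_tile ` path_pieces \<theta> n1 \<or> t \<inter> ball 0 R = {}"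
      by fast
    then show ?thesis
    proof
      assume "t \<in> piece_tile ` path_pieces \<theta> n1"
      then have "t \<in> inf_tiling G f a \<phi>" using sub(1) by blast
      then show ?thesis
        using r S.mdist_zero[OF stereo_tile[OF T t]] by (intro bexI[of _ t]) auto
    next
      assume out: "t \<inter> ball 0 R = {}"
      have q': "piece_tile q \<in> inf_tiling G f a \<phi>" using sub(2) q(1) by blast
      have "sphere_hyperspace_dist (stereo ` t) (stereo ` piece_tile q) \<le> r"
        using out q(2) tile_properties(2)[OF T t] tile_properties(2)[OF T' q'] by (rule outside)
      then show ?thesis
        using q' r by (intro bexI[of _ "piece_tile q"]) auto
    qed
  qed
  have "tiling_dist (inf_tiling G f a \<theta>) (inf_tiling G f a \<psi>) < e"
    if \<psi>: "\<psi> \<in> inf_paths (reverse_digraph G)" "\<forall>i<n. \<psi> i = \<theta> i" for \<psi>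
  proof -
    have "tiling_dist (inf_tiling G f a \<theta>) (inf_tiling G f a \<psi>) \<le> 2 * (r + r / 2)"
      using \<theta> \<psi> r near[of \<theta> \<psi>] near[of \<psi> \<theta>]
      by (intro tiling_dist_le inf_tiling_in_tilings) auto
    also have "\<dots> < e" using r by (simp add: r_def)
    finally show ?thesis .
  qed
  then show ?thesis by blast
qed

section \<open>Upper semi-continuity\<close>

text \<open>A tile of the limit path belongs to some stage, so all tilings from some index on
  contain it; by their convergence it is a limit of tiles of \<open>T\<close>, hence one of
  them.\<close>

lemma inf_tiling_upper_semicontinuous:
  assumes \<theta>s: "\<And>n. \<theta>s n \<in> inf_paths (reverse_digraph G)" and \<theta>: "\<theta> \<in> inf_paths (reverse_digraph G)"
    and lim: "limitin (path_topology (reverse_digraph G)) \<theta>s \<theta> sequentially"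
    and T: "T \<in> tilings G f a"
    and limT: "limitin (tiling_topology G f a) (\<lambda>n. inf_tiling G f a (\<theta>s n)) T sequentially"
  shows "inf_tiling G f a \<theta> \<subseteq> T"
proof
  interpret P: Metric_space "inf_paths (reverse_digraph G)" path_dist
    by (rule Metric_space_path_dist)
  interpret T: Metric_space "tilings G f a" tiling_dist
    by (rule Metric_space_tiling_dist)
  fix t assume t: "t \<in> inf_tiling G f a \<theta>"
  then obtain k q where q: "q \<in> path_pieces \<theta> k" "t = piece_tile q"
    unfolding inf_tiling_eq[OF \<theta>] by blast
  \<comment> \<open>Agreement on one edge more than the stage keeps the common prefix nonempty, so
    that it determines the vertex.\<close>
  have "\<forall>\<^sub>F n in sequentially. path_dist (\<theta>s n) \<theta> < 1 / 2 ^ Suc k"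
    using lim unfolding path_topology_def P.limit_metric_sequentially eventually_sequentially
    by (meson divide_pos_pos zero_less_numeral zero_less_one zero_less_power)
  then have ev: "\<forall>\<^sub>F n in sequentially. t \<in> inf_tiling G f a (\<theta>s n)"
  proof eventually_elim
    case (elim n)
    then have "\<And>i. i < Suc k \<Longrightarrow> \<theta>s n i = \<theta> i"
      unfolding path_dist_less_iff by blast
    from inf_tiling_prefix_subset[of \<theta> "\<theta>s n" "Suc k" k, OF \<theta> \<theta>s this] show ?case
      using q by auto
  qed
  show "t \<in> T"
  proof (rule tile_limit_in_tiling[OF T tile_properties[OF inf_tiling_in_tilings[OF \<theta>] t]])
    fix e :: real assume e: "e > 0"
    have "\<forall>\<^sub>F n in sequentially. tiling_dist (inf_tiling G f a (\<theta>s n)) T < e"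
      using limT e unfolding tiling_topology_def T.limit_metric_sequentially eventually_sequentially
      by blast
    with ev have "\<forall>\<^sub>F n in sequentially. t \<in> inf_tiling G f a (\<theta>s n) \<and>
        tiling_dist (inf_tiling G f a (\<theta>s n)) T < e"
      by (rule eventually_conj)
    then obtain n where n: "t \<in> inf_tiling G f a (\<theta>s n)" "tiling_dist (inf_tiling G f a (\<theta>s n)) T < e"
      by (auto simp: eventually_sequentially)
    then show "\<exists>t'\<in>T. sphere_hyperspace_dist (stereo ` t) (stereo ` t') < e"
      by (intro tiling_dist_lessD[OF inf_tiling_in_tilings[OF \<theta>s] T])
  qed
qed

section \<open>Continuity on the reversible paths\<close>

text \<open>Cylinders are balls of \<open>path_dist\<close>, so the statement about common prefixes
  is the metric criterion on the subspace.\<close>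

lemma continuous_map_inf_tiling:
  "continuous_map (subtopology (path_topology (reverse_digraph G)) (reversible_paths G f))
    (tiling_topology G f a) (inf_tiling G f a)"
proof -
  interpret P: Submetric "inf_paths (reverse_digraph G)" path_dist "reversible_paths G f"
    by (intro Submetric.intro Metric_space_path_dist Submetric_axioms.intro)
      (auto simp: reversible_paths_def)
  have "\<exists>\<delta>>0. \<forall>\<psi>. \<psi> \<in> reversible_paths G f \<and> path_dist \<theta> \<psi> < \<delta> \<longrightarrow>
      tiling_dist (inf_tiling G f a \<theta>) (inf_tiling G f a \<psi>) < e"
    if \<theta>: "\<theta> \<in> reversible_paths G f" and e: "e > 0" for \<theta> e
  proof -
    obtain n where n: "\<And>\<psi>. \<lbrakk>\<psi> \<in> inf_paths (reverse_digraph G); \<forall>i<n. \<psi> i = \<theta> i\<rbrakk>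
        \<Longrightarrow> tiling_dist (inf_tiling G f a \<theta>) (inf_tiling G f a \<psi>) < e"
      using reversible_continuous_at[OF \<theta> e] by blast
    show ?thesis
    proof (intro exI conjI allI impI)
      fix \<psi> assume \<psi>: "\<psi> \<in> reversible_paths G f \<and> path_dist \<theta> \<psi> < 1 / 2 ^ n"
      then have "\<forall>i<n. \<theta> i = \<psi> i"
        unfolding path_dist_less_iff by blast
      then show "tiling_dist (inf_tiling G f a \<theta>) (inf_tiling G f a \<psi>) < e"
        using \<psi> P.subset by (intro n) auto
    qed simp
  qed
  moreover have "inf_tiling G f a ` reversible_paths G f \<subseteq> tilings G f a"
    using P.subset inf_tiling_in_tilings by blast
  ultimately show ?thesis
    unfolding path_topology_def tiling_topology_def P.mtopology_submetric[symmetric]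
      P.sub.metric_continuous_map[OF Metric_space_tiling_dist]
    by blast
qed

end

theorem theorem7:
  fixes G :: "('v, nat) pre_digraph"
    and N :: nat
    and f :: "nat \<Rightarrow> real^'m \<Rightarrow> real^'m"
    and s :: real
    and a :: "nat \<Rightarrow> nat"
  assumes "tiling_ifs G N f s a"
  shows "continuous_map
           (subtopology (path_topology (reverse_digraph G)) (reversible_paths G f))
           (tiling_topology G f a)
           (inf_tiling G f a) \<and>
         (\<forall>(\<theta>s :: nat \<Rightarrow> nat \<Rightarrow> nat) \<theta> T.
           (\<forall>n. \<theta>s n \<in> inf_paths (reverse_digraph G)) \<and>
           \<theta> \<in> inf_paths (reverse_digraph G) \<and>
           limitin (path_topology (reverse_digraph G)) \<theta>s \<theta> sequentially \<and>
           T \<in> tilings G f a \<and>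
           limitin (tiling_topology G f a) (\<lambda>n. inf_tiling G f a (\<theta>s n)) T sequentially
           \<longrightarrow> inf_tiling G f a \<theta> \<subseteq> T)"
proof -
  interpret tiling_ifs G N f s a by fact
  show ?thesis
    using continuous_map_inf_tiling inf_tiling_upper_semicontinuous by blast
qed

end
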